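(* Let $d\ge 1$ and let $Y$ be a locally finite $d$-dimensional simplicial complex such that $\pi_d(Y)$ vanishes. Let $F_1, \dots, F_{d+1}$ be finite families of subcomplexes of $Y$ such that for every nonempty $I\subset [d+1]=\{1,\dots,d+1\}$ and for every choice $S_i\in F_i$ with $i\in I$, $\pi_{d-|I|}\big(\bigcap_{i\in I}S_i\big)$ is trivial. Then there are a point $y\in \|Y\|$ and an index $i\in[d+1]$ such that $y$ belongs to every member of $F_i$.
   Context: For a (locally finite) simplicial complex $Y$, $\|Y\|$ denotes its polyhedron: the underlying topological space, i.e. the union of its simplices with the topology induced by the geometric realization. For a topological space $X$ we say $\pi_k(X)$ is trivial if: $X$ is nonempty (for $k=-1$); $X$ is path-connected (for $k=0$); $\pi_k(X)=0$ (for $k\geq 1$; for all base points). Homotopy groups of a (sub)complex are those of its polyhedron. *)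

theory Defs
  imports "HOL-Analysis.Analysis"
begin

section \<open>Abstract simplicial complexes\<close>

text \<open>
  A complex is given by its set of nonempty simplices over an arbitrary vertex type.
  The empty complex is allowed.
\<close>

definition abstract_complex :: "'a set set \<Rightarrow> bool" where
  "abstract_complex K \<longleftrightarrow>
     (\<forall>\<sigma>\<in>K. finite \<sigma> \<and> \<sigma> \<noteq> {} \<and> (\<forall>\<tau>. \<tau> \<subseteq> \<sigma> \<and> \<tau> \<noteq> {} \<longrightarrow> \<tau> \<in> K))"

definition subcomplex :: "'a set set \<Rightarrow> 'a set set \<Rightarrow> bool" where
  "subcomplex L K \<longleftrightarrow> abstract_complex L \<and> L \<subseteq> K"

definition locally_finite_complex :: "'a set set \<Rightarrow> bool" where
  "locally_finite_complex K \<longleftrightarrow> (\<forall>v. finite {\<sigma> \<in> K. v \<in> \<sigma>})"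

definition complex_of_dim :: "nat \<Rightarrow> 'a set set \<Rightarrow> bool" where
  "complex_of_dim d K \<longleftrightarrow> (\<forall>\<sigma>\<in>K. card \<sigma> \<le> d + 1) \<and> (\<exists>\<sigma>\<in>K. card \<sigma> = d + 1)"

section \<open>Geometric realization\<close>

text \<open>Points are functions assigning to each vertex its barycentric coordinate.\<close>

definition closed_simplex :: "'a set \<Rightarrow> ('a \<Rightarrow> real) set" where
  "closed_simplex \<sigma> = {x. (\<forall>v. 0 \<le> x v) \<and> (\<forall>v. v \<notin> \<sigma> \<longrightarrow> x v = 0) \<and> (\<Sum>v\<in>\<sigma>. x v) = 1}"

text \<open>
  The polyhedron carries the weak (coherent) topology: a set is open iff its trace on every
  closed simplex is open there. As \<open>\<sigma>\<close> is finite, the product topology induces on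
  \<open>closed_simplex \<sigma>\<close> its usual Euclidean topology.
\<close>

definition realization :: "'a set set \<Rightarrow> ('a \<Rightarrow> real) topology" where
  "realization K = topology (\<lambda>U. U \<subseteq> (\<Union>\<sigma>\<in>K. closed_simplex \<sigma>) \<and>
     (\<forall>\<sigma>\<in>K. openin (subtopology (powertop_real UNIV) (closed_simplex \<sigma>)) (U \<inter> closed_simplex \<sigma>)))"

lemma openin_realization:
  "openin (realization K) U \<longleftrightarrow> U \<subseteq> (\<Union>\<sigma>\<in>K. closed_simplex \<sigma>) \<and>
     (\<forall>\<sigma>\<in>K. openin (subtopology (powertop_real UNIV) (closed_simplex \<sigma>)) (U \<inter> closed_simplex \<sigma>))"
proof -
  have "istopology (\<lambda>U. U \<subseteq> (\<Union>\<sigma>\<in>K. closed_simplex \<sigma>) \<and>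
     (\<forall>\<sigma>\<in>K. openin (subtopology (powertop_real UNIV) (closed_simplex \<sigma>)) (U \<inter> closed_simplex \<sigma>)))"
    (is "istopology ?T")
    unfolding istopology_def
  proof (intro conjI allI impI)
    fix S T assume S: "?T S" and T: "?T T"
    then show "S \<inter> T \<subseteq> (\<Union>\<sigma>\<in>K. closed_simplex \<sigma>)" by blast
    show "\<forall>\<sigma>\<in>K. openin (subtopology (powertop_real UNIV) (closed_simplex \<sigma>))
            (S \<inter> T \<inter> closed_simplex \<sigma>)"
    proof
      fix \<sigma> assume "\<sigma> \<in> K"
      then have "openin (subtopology (powertop_real UNIV) (closed_simplex \<sigma>))
          ((S \<inter> closed_simplex \<sigma>) \<inter> (T \<inter> closed_simplex \<sigma>))"
        using S T by (meson openin_Int)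
      then show "openin (subtopology (powertop_real UNIV) (closed_simplex \<sigma>))
            (S \<inter> T \<inter> closed_simplex \<sigma>)"
        by (simp add: Int_ac)
    qed
  next
    fix \<U> assume U: "\<forall>S\<in>\<U>. ?T S"
    then show "\<Union>\<U> \<subseteq> (\<Union>\<sigma>\<in>K. closed_simplex \<sigma>)" by blast
    show "\<forall>\<sigma>\<in>K. openin (subtopology (powertop_real UNIV) (closed_simplex \<sigma>))
            (\<Union>\<U> \<inter> closed_simplex \<sigma>)"
      unfolding Int_Union2 using U by (intro ballI openin_Union) auto
  qed
  then show ?thesis
    unfolding realization_def by (simp add: topology_inverse')
qed

lemma topspace_realization: "topspace (realization K) = (\<Union>\<sigma>\<in>K. closed_simplex \<sigma>)"
proof (rule antisym)
  show "topspace (realization K) \<subseteq> (\<Union>\<sigma>\<in>K. closed_simplex \<sigma>)"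
    using openin_topspace[of "realization K"] unfolding openin_realization by blast
  have "(\<Union>\<tau>\<in>K. closed_simplex \<tau>) \<inter> closed_simplex \<sigma>
      = topspace (subtopology (powertop_real UNIV) (closed_simplex \<sigma>))" if "\<sigma> \<in> K" for \<sigma>
    using that by auto
  then have "openin (realization K) (\<Union>\<sigma>\<in>K. closed_simplex \<sigma>)"
    unfolding openin_realization by (metis openin_topspace order_refl)
  then show "(\<Union>\<sigma>\<in>K. closed_simplex \<sigma>) \<subseteq> topspace (realization K)"
    by (rule openin_subset)
qed

section \<open>Homotopy groups\<close>

definition unit_cube :: "nat \<Rightarrow> (nat \<Rightarrow> real) topology" where
  "unit_cube n = product_topology (\<lambda>_. top_of_set {0..1}) {..<n}"

definition unit_cube_boundary :: "nat \<Rightarrow> (nat \<Rightarrow> real) set" where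
  "unit_cube_boundary n = {t \<in> topspace (unit_cube n). \<exists>i<n. t i = 0 \<or> t i = 1}"

definition spheroids :: "nat \<Rightarrow> 'b topology \<Rightarrow> 'b \<Rightarrow> ((nat \<Rightarrow> real) \<Rightarrow> 'b) set" where
  "spheroids n X x0 = {f. continuous_map (unit_cube n) X f \<and> (\<forall>t\<in>unit_cube_boundary n. f t = x0)}"

definition spheroid_homotopy ::
    "nat \<Rightarrow> 'b topology \<Rightarrow> 'b \<Rightarrow> (((nat \<Rightarrow> real) \<Rightarrow> 'b) \<times> ((nat \<Rightarrow> real) \<Rightarrow> 'b)) set" where
  "spheroid_homotopy n X x0 = {(f, g). f \<in> spheroids n X x0 \<and> g \<in> spheroids n X x0 \<and>
     homotopic_with (\<lambda>h. \<forall>t\<in>unit_cube_boundary n. h t = x0) (unit_cube n) X f g}"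

text \<open>
  The underlying set of the homotopy group of \<open>(X, x0)\<close> in degree \<open>n\<close>. The multiplication is not
  needed: a group is trivial iff its underlying set has exactly one element.
\<close>

definition homotopy_group :: "nat \<Rightarrow> 'b topology \<Rightarrow> 'b \<Rightarrow> ((nat \<Rightarrow> real) \<Rightarrow> 'b) set set" where
  "homotopy_group n X x0 = spheroids n X x0 // spheroid_homotopy n X x0"

text \<open>
  Only degrees \<open>k \<ge> -1\<close> are meaningful. For \<open>k \<ge> 0\<close> the empty space satisfies the condition, since
  it is path-connected in the sense of \<^const>\<open>path_connected_space\<close> and has no base points.
\<close>

definition pi_trivial :: "int \<Rightarrow> 'b topology \<Rightarrow> bool" where
  "pi_trivial k X \<longleftrightarrow>
     (if k = -1 then topspace X \<noteq> {}
      else if k = 0 then path_connected_space X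
      else \<forall>x0\<in>topspace X. is_singleton (homotopy_group (nat k) X x0))"

end

theory Submission imports Defs begin

text \<open>
  Suppose that no point lies in all members of one family. Enumerate the \<open>i\<close>-th family as
  \<open>S i 0, \<dots>, S i p\<close> with indices \<open>i < n\<close>, where \<open>n = d + 1\<close>. The hypothesis on homotopy groups is
  exactly what is needed to construct, cube by cube on the skeleta of the integer grid, a continuous
  map \<open>G\<close> from the box \<open>[0, p]\<^sup>n\<close> to the polyhedron of \<open>Y\<close> such that \<open>G x\<close> lies in \<open>S i m\<close> whenever
  \<open>x i = m\<close>.

  Conversely, every \<open>j\<close>-dimensional face \<open>\<sigma>\<close> of \<open>Y\<close> is missing from some \<open>S j m\<close>. Sending the barycentre
  of \<open>\<sigma>\<close> to \<open>m\<close> on the \<open>j\<close>-th axis defines a continuous map \<open>Q\<close> from the polyhedron to the box such that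
  for each \<open>y\<close> there are \<open>j\<close> and \<open>m\<close> with \<open>Q y j = m\<close> and \<open>y\<close> not in \<open>S j m\<close>. At a fixed point \<open>x\<close> of
  \<open>Q \<circ> G\<close>, which exists by Brouwer's theorem, \<open>G x\<close> would both belong and not belong to \<open>S j m\<close>.
\<close>

section \<open>Brouwer's theorem with the dimension as a natural number\<close>

lemma tendsto_funI:
  fixes f :: "'b \<Rightarrow> 'i \<Rightarrow> real"
  assumes "\<And>i. ((\<lambda>x. f x i) \<longlongrightarrow> l i) F"
  shows "(f \<longlongrightarrow> l) F"
proof -
  have "limitin (product_topology (\<lambda>i. euclideanreal) UNIV) f l F"
    using assms by (simp add: limitin_componentwise)
  then show ?thesis
    by (simp add: euclidean_product_topology)
qed

lemma tendsto_funD: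
  fixes f :: "'b \<Rightarrow> 'i \<Rightarrow> real"
  assumes "(f \<longlongrightarrow> l) F"
  shows "((\<lambda>x. f x i) \<longlongrightarrow> l i) F"
proof -
  have "limitin (product_topology (\<lambda>i. euclideanreal) UNIV) f l F"
    using assms by (simp add: euclidean_product_topology)
  then show ?thesis
    by (simp add: limitin_componentwise)
qed

text \<open>The dimension \<open>n\<close> is a term rather than a type, as it has to equal d + 1
  later. Coordinates from \<open>n\<close> on are pinned to 0, which keeps the box compact inside
  the infinite product.\<close>

definition box_real :: "nat \<Rightarrow> real \<Rightarrow> (nat \<Rightarrow> real) set" where
  "box_real n c = {x. (\<forall>i<n. 0 \<le> x i \<and> x i \<le> c) \<and> (\<forall>i\<ge>n. x i = 0)}"

lemma compact_box_real: "compact (box_real n c)"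
proof -
  have eq: "box_real n c = PiE UNIV (\<lambda>i. if i < n then {0..c} else {0})"
    by (auto simp: box_real_def PiE_iff split: if_splits)
  have "compactin (product_topology (\<lambda>i. euclideanreal) UNIV) (box_real n c)"
    unfolding eq by (subst compactin_PiE) auto
  then show ?thesis
    by (simp add: euclidean_product_topology)
qed

text \<open>Kuhn's combinatorial lemma yields, for each mesh, a small cell in which every coordinate
  receives both labels. By compactness these cells accumulate at a point, where the two labels of
  coordinate \<open>i\<close> give the two inequalities between \<open>f x i\<close> and
  \<open>x i\<close>.\<close>

lemma brouwer_box_real:
  assumes c: "0 < c"
    and cont: "continuous_on (box_real n c) f"
    and maps: "\<And>x. x \<in> box_real n c \<Longrightarrow> f x \<in> box_real n c"
  obtains x where "x \<in> box_real n c" "f x = x"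
proof -
  define pt where "pt P x = (\<lambda>i. if i < n then c * real (x i) / real P else 0)"
    for P :: nat and x :: "nat \<Rightarrow> nat"
  \<comment> \<open>Label 0 records that \<open>f\<close> does not decrease coordinate
    \<open>i\<close>, label 1 that it does not increase it. The clauses for \<open>x i = 0\<close>
    and \<open>x i = P\<close> enforce the boundary conditions of Kuhn's lemma; they keep this
    meaning because \<open>f\<close> maps the box into itself.\<close>
  define label where
    "label P x i = (if x i = 0 \<or> (x i \<noteq> P \<and> pt P x i \<le> f (pt P x) i) then 0 else 1 :: nat)"
    for P x i
  have pt_in: "pt P x \<in> box_real n c" if "0 < P" "\<forall>i<n. x i \<le> P" for P x
    using that c by (auto simp: pt_def box_real_def field_simps)
  have l0: "pt P x i \<le> f (pt P x) i"
    if "0 < P" "\<forall>i<n. x i \<le> P" "i < n" "label P x i = 0" for P x i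
    using maps[OF pt_in[OF that(1,2)]] that
    by (auto simp: label_def pt_def box_real_def split: if_splits)
  have l1: "f (pt P x) i \<le> pt P x i"
    if "0 < P" "\<forall>i<n. x i \<le> P" "i < n" "label P x i \<noteq> 0" for P x i
    using maps[OF pt_in[OF that(1,2)]] that
    by (auto simp: label_def pt_def box_real_def split: if_splits)
  have "\<exists>q. (\<forall>i<n. q i < Suc m) \<and>
      (\<forall>i<n. \<exists>r s. (\<forall>j<n. q j \<le> r j \<and> r j \<le> q j + 1) \<and> (\<forall>j<n. q j \<le> s j \<and> s j \<le> q j + 1) \<and>
         label (Suc m) r i = 0 \<and> label (Suc m) s i \<noteq> 0)" for m
  proof -
    obtain q where q: "\<forall>i<n. q i < Suc m"
      "\<forall>i<n. \<exists>r s. (\<forall>j<n. q j \<le> r j \<and> r j \<le> q j + 1) \<and> (\<forall>j<n. q j \<le> s j \<and> s j \<le> q j + 1) \<and>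
         label (Suc m) r i \<noteq> label (Suc m) s i"
      by (rule kuhn_lemma[of "Suc m" n "label (Suc m)"]) (auto simp: label_def)
    \<comment> \<open>Kuhn's lemma only says that the two labels differ. As they are 0 or 1,
      swapping \<open>r\<close> and \<open>s\<close> if necessary makes \<open>r\<close> the vertex
      labelled 0.\<close>
    have "\<exists>r s. (\<forall>j<n. q j \<le> r j \<and> r j \<le> q j + 1) \<and> (\<forall>j<n. q j \<le> s j \<and> s j \<le> q j + 1) \<and>
         label (Suc m) r i = 0 \<and> label (Suc m) s i \<noteq> 0" if i: "i < n" for i
    proof -
      obtain r s where rs: "\<forall>j<n. q j \<le> r j \<and> r j \<le> q j + 1"
        "\<forall>j<n. q j \<le> s j \<and> s j \<le> q j + 1" "label (Suc m) r i \<noteq> label (Suc m) s i"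
        using q(2) i by blast
      show ?thesis
      proof (cases "label (Suc m) r i = 0")
        case True
        with rs show ?thesis by metis
      next
        case False
        then have "label (Suc m) s i = 0"
          using rs(3) by (auto simp: label_def split: if_splits)
        with rs False show ?thesis by metis
      qed
    qed
    with q(1) show ?thesis by blast
  qed
  then obtain q where q: "\<forall>m. (\<forall>i<n. q m i < Suc m) \<and>
      (\<forall>i<n. \<exists>r s. (\<forall>j<n. q m j \<le> r j \<and> r j \<le> q m j + 1) \<and>
         (\<forall>j<n. q m j \<le> s j \<and> s j \<le> q m j + 1) \<and>
         label (Suc m) r i = 0 \<and> label (Suc m) s i \<noteq> 0)"
    by (rule choice[OF allI, THEN exE])
  then have q1: "\<And>m i. i < n \<Longrightarrow> q m i < Suc m" by blast
  have "\<forall>m. pt (Suc m) (q m) \<in> box_real n c"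
    using q1 by (intro allI pt_in) (auto intro: less_imp_le)
  then obtain x \<phi> where x: "x \<in> box_real n c" and \<phi>: "strict_mono \<phi>"
    and lim: "((\<lambda>m. pt (Suc m) (q m)) \<circ> \<phi>) \<longlonglongrightarrow> x"
    by (rule seq_compactE[OF compact_imp_seq_compact[OF compact_box_real]])
  \<comment> \<open>Whatever vertex \<open>t\<close> of the cells is selected, the limit is the
    same, since the cells have side \<open>c / real (Suc (\<phi> m))\<close>.\<close>
  have near: "(\<lambda>m. pt (Suc (\<phi> m)) (t (\<phi> m))) \<longlonglongrightarrow> x"
    if t: "\<And>m j. j < n \<Longrightarrow> q m j \<le> t m j \<and> t m j \<le> q m j + 1" for t
  proof (rule tendsto_funI)
    fix j
    have z: "(\<lambda>m. c / real (Suc (\<phi> m))) \<longlonglongrightarrow> 0"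
      using LIMSEQ_subseq_LIMSEQ[OF _ \<phi>, of "\<lambda>m. c / real (Suc m)" 0]
        lim_const_over_n[of c, THEN LIMSEQ_Suc] by (simp add: o_def)
    have d: "\<bar>pt (Suc (\<phi> m)) (t (\<phi> m)) j - pt (Suc (\<phi> m)) (q (\<phi> m)) j\<bar> \<le> c / real (Suc (\<phi> m))" for m
    proof (cases "j < n")
      case True
      have "pt (Suc (\<phi> m)) (t (\<phi> m)) j - pt (Suc (\<phi> m)) (q (\<phi> m)) j
          = c * (real (t (\<phi> m) j) - real (q (\<phi> m) j)) / real (Suc (\<phi> m))"
        using True by (simp add: pt_def diff_divide_distrib right_diff_distrib)
      moreover have "\<bar>real (t (\<phi> m) j) - real (q (\<phi> m) j)\<bar> \<le> 1"
        using t[OF True, of "\<phi> m"] by linarith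
      ultimately show ?thesis
        using c by (simp add: abs_mult divide_right_mono)
    qed (use c in \<open>simp add: pt_def\<close>)
    have "(\<lambda>m. pt (Suc (\<phi> m)) (t (\<phi> m)) j - pt (Suc (\<phi> m)) (q (\<phi> m)) j) \<longlonglongrightarrow> 0"
      using d by (intro Lim_null_comparison[OF always_eventually z] allI) simp
    moreover have "(\<lambda>m. pt (Suc (\<phi> m)) (q (\<phi> m)) j) \<longlonglongrightarrow> x j"
      using tendsto_funD[OF lim, of j] by (simp add: o_def)
    ultimately show "(\<lambda>m. pt (Suc (\<phi> m)) (t (\<phi> m)) j) \<longlonglongrightarrow> x j"
      by (rule Lim_transform[rotated])
  qed
  have flim: "(\<lambda>m. f (pt (Suc (\<phi> m)) (t (\<phi> m))) i) \<longlonglongrightarrow> f x i"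
    if t: "\<And>m j. j < n \<Longrightarrow> q m j \<le> t m j \<and> t m j \<le> q m j + 1" for t i
  proof -
    have "pt (Suc (\<phi> m)) (t (\<phi> m)) \<in> box_real n c" for m
    proof (rule pt_in)
      show "\<forall>i<n. t (\<phi> m) i \<le> Suc (\<phi> m)"
        using t[of _ "\<phi> m"] q1[of _ "\<phi> m"] by fastforce
    qed simp
    then have "(\<lambda>m. f (pt (Suc (\<phi> m)) (t (\<phi> m)))) \<longlonglongrightarrow> f x"
      using continuous_on_tendsto_compose[OF cont near[OF t] x] by simp
    then show ?thesis by (rule tendsto_funD)
  qed
  have tn: "\<forall>j<n. t j \<le> Suc m" if "\<And>j. j < n \<Longrightarrow> q m j \<le> t j \<and> t j \<le> q m j + 1" for t m
    using that q1[of _ m] by fastforce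
  have "f x i = x i" if i: "i < n" for i
  proof (rule antisym)
    \<comment> \<open>The vertices \<open>r\<close> and \<open>s\<close> depend on the coordinate
      \<open>i\<close>, so they are chosen anew for each \<open>i\<close>; only the limit
      \<open>x\<close> is shared.\<close>
    have "\<forall>m. \<exists>r. (\<forall>j<n. q m j \<le> r j \<and> r j \<le> q m j + 1) \<and> label (Suc m) r i = 0"
      using q i by blast
    then obtain r where r: "\<And>m. (\<forall>j<n. q m j \<le> r m j \<and> r m j \<le> q m j + 1) \<and> label (Suc m) (r m) i = 0"
      by (rule choice[THEN exE]) blast
    have "pt (Suc m) (r m) i \<le> f (pt (Suc m) (r m)) i" for m
      using r by (intro l0 tn i) auto
    then show "x i \<le> f x i"
      using r by (intro LIMSEQ_le[OF tendsto_funD[OF near[of r]] flim[of r]]) auto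
    have "\<forall>m. \<exists>s. (\<forall>j<n. q m j \<le> s j \<and> s j \<le> q m j + 1) \<and> label (Suc m) s i \<noteq> 0"
      using q i by blast
    then obtain s where s: "\<And>m. (\<forall>j<n. q m j \<le> s m j \<and> s m j \<le> q m j + 1) \<and> label (Suc m) (s m) i \<noteq> 0"
      by (rule choice[THEN exE]) blast
    have "f (pt (Suc m) (s m)) i \<le> pt (Suc m) (s m) i" for m
      using s by (intro l1 tn i) auto
    then show "f x i \<le> x i"
      using s by (intro LIMSEQ_le[OF flim[of s] tendsto_funD[OF near[of s]]]) auto
  qed
  moreover have "f x i = x i" if "\<not> i < n" for i
    using maps[OF x] x that by (auto simp: box_real_def)
  ultimately have "f x = x" by blast
  with x show thesis by (rule that)
qed

section \<open>Polyhedra\<close>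

text \<open>The support of a point is a nonempty face of every simplex whose closed simplex contains
  the point. Closure under faces therefore reduces membership to a test on that one simplex.\<close>

lemma mem_realization_iff:
  assumes "abstract_complex K"
  shows "y \<in> topspace (realization K) \<longleftrightarrow>
    {v. y v \<noteq> 0} \<in> K \<and> (\<forall>v. 0 \<le> y v) \<and> (\<Sum>v | y v \<noteq> 0. y v) = 1"
proof
  assume "y \<in> topspace (realization K)"
  then obtain \<sigma> where \<sigma>: "\<sigma> \<in> K" "y \<in> closed_simplex \<sigma>"
    by (auto simp: topspace_realization)
  have fin: "finite \<sigma>" using assms \<sigma>(1) by (auto simp: abstract_complex_def)
  have sub: "{v. y v \<noteq> 0} \<subseteq> \<sigma>" using \<sigma>(2) by (auto simp: closed_simplex_def)
  have "(\<Sum>v | y v \<noteq> 0. y v) = (\<Sum>v\<in>\<sigma>. y v)"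
    by (rule sum.mono_neutral_left[OF fin sub]) auto
  then have sum1: "(\<Sum>v | y v \<noteq> 0. y v) = 1"
    using \<sigma>(2) by (simp add: closed_simplex_def)
  then have "{v. y v \<noteq> 0} \<noteq> {}" by force
  then have "{v. y v \<noteq> 0} \<in> K"
    using assms \<sigma>(1) sub unfolding abstract_complex_def by blast
  with sum1 \<sigma>(2) show "{v. y v \<noteq> 0} \<in> K \<and> (\<forall>v. 0 \<le> y v) \<and> (\<Sum>v | y v \<noteq> 0. y v) = 1"
    by (auto simp: closed_simplex_def)
qed (auto simp: topspace_realization closed_simplex_def)

text \<open>The inclusion of polyhedra is continuous: on a simplex of \<open>L\<close>, an open set
  and its trace on the polyhedron of \<open>L\<close> cut out the same set.\<close>

lemma continuous_map_realization_mono: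
  assumes "continuous_map T (realization L) f" "L \<subseteq> K"
  shows "continuous_map T (realization K) f"
proof -
  have sub: "topspace (realization L) \<subseteq> topspace (realization K)"
    using assms(2) by (auto simp: topspace_realization)
  have "openin (realization L) (U \<inter> topspace (realization L))" if "openin (realization K) U" for U
  proof -
    have "U \<inter> topspace (realization L) \<inter> closed_simplex \<sigma> = U \<inter> closed_simplex \<sigma>" if "\<sigma> \<in> L" for \<sigma>
      using that by (auto simp: topspace_realization)
    with that assms(2) show ?thesis
      by (auto simp: openin_realization topspace_realization)
  qed
  then have "continuous_map (realization L) (realization K) id"
    using sub by (auto simp: continuous_map_def Int_def conj_commute)
  from continuous_map_compose[OF assms(1) this] show ?thesis by simp
qed

text \<open>This is the universal property of the weak topology.\<close>

lemma continuous_map_from_realization: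
  fixes f :: "('a \<Rightarrow> real) \<Rightarrow> 'b::topological_space"
  assumes "\<And>\<sigma>. \<sigma> \<in> K \<Longrightarrow> continuous_on (closed_simplex \<sigma>) f"
  shows "continuous_map (realization K) euclidean f"
  unfolding continuous_map_def
proof (intro conjI allI impI)
  fix U :: "'b set" assume U: "openin euclidean U"
  show "openin (realization K) {x \<in> topspace (realization K). f x \<in> U}"
    unfolding openin_realization
  proof (intro conjI ballI)
    fix \<sigma> assume \<sigma>: "\<sigma> \<in> K"
    have "{x \<in> topspace (realization K). f x \<in> U} \<inter> closed_simplex \<sigma> = closed_simplex \<sigma> \<inter> f -` U"
      using \<sigma> by (auto simp: topspace_realization)
    moreover have "openin (top_of_set (closed_simplex \<sigma>)) (closed_simplex \<sigma> \<inter> f -` U)"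
      using U by (intro continuous_openin_preimage_gen[OF assms[OF \<sigma>]]) simp
    ultimately show "openin (subtopology (powertop_real UNIV) (closed_simplex \<sigma>))
        ({x \<in> topspace (realization K). f x \<in> U} \<inter> closed_simplex \<sigma>)"
      by (simp add: euclidean_product_topology)
  qed (auto simp: topspace_realization)
qed auto

section \<open>Extending maps from the boundary of a cube\<close>

definition sup_abs :: "'i set \<Rightarrow> ('i \<Rightarrow> real) \<Rightarrow> real" where
  "sup_abs A z = Max (insert 0 ((\<lambda>i. \<bar>z i\<bar>) ` A))"

lemma sup_abs_le_iff: "finite A \<Longrightarrow> sup_abs A z \<le> c \<longleftrightarrow> 0 \<le> c \<and> (\<forall>i\<in>A. \<bar>z i\<bar> \<le> c)"
  by (auto simp: sup_abs_def)

lemma sup_abs_nonneg: "finite A \<Longrightarrow> 0 \<le> sup_abs A z"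
  by (auto simp: sup_abs_def)

lemma abs_le_sup_abs: "finite A \<Longrightarrow> i \<in> A \<Longrightarrow> \<bar>z i\<bar> \<le> sup_abs A z"
  by (auto simp: sup_abs_def)

lemma sup_abs_attained:
  assumes "finite A" "sup_abs A z \<noteq> 0"
  shows "\<exists>i\<in>A. \<bar>z i\<bar> = sup_abs A z"
proof -
  have "sup_abs A z \<in> insert 0 ((\<lambda>i. \<bar>z i\<bar>) ` A)"
    unfolding sup_abs_def using assms(1) by (intro Max_in) auto
  with assms(2) show ?thesis by force
qed

text \<open>One inequality is direct; the other is the same inequality for the factor
  \<open>inverse r\<close> applied to the scaled vector.\<close>

lemma sup_abs_scale:
  assumes "finite A"
  shows "sup_abs A (\<lambda>i. r * z i) = \<bar>r\<bar> * sup_abs A z"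
proof (cases "r = 0")
  case True
  then show ?thesis by (auto simp: sup_abs_def image_constant_conv)
next
  case False
  have le: "sup_abs A (\<lambda>i. s * w i) \<le> \<bar>s\<bar> * sup_abs A w" for s and w :: "'a \<Rightarrow> real"
    using assms by (auto simp: sup_abs_le_iff sup_abs_nonneg abs_mult intro!: mult_left_mono abs_le_sup_abs)
  have "sup_abs A z \<le> \<bar>inverse r\<bar> * sup_abs A (\<lambda>i. r * z i)"
    using le[of "inverse r" "\<lambda>i. r * z i"] False by (simp add: mult.assoc[symmetric])
  then have "\<bar>r\<bar> * sup_abs A z \<le> sup_abs A (\<lambda>i. r * z i)"
    using False by (simp add: field_simps)
  with le[of r z] show ?thesis by simp
qed

lemma continuous_on_Max_image:
  fixes f :: "'i \<Rightarrow> 'b::topological_space \<Rightarrow> real"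
  assumes "finite A" "A \<noteq> {}" "\<And>i. i \<in> A \<Longrightarrow> continuous_on S (f i)"
  shows "continuous_on S (\<lambda>x. Max ((\<lambda>i. f i x) ` A))"
  using assms
proof (induction A rule: finite_ne_induct)
  case (insert i A)
  then show ?case by (auto intro!: continuous_on_max)
qed simp

lemma continuous_on_Min_image:
  fixes f :: "'i \<Rightarrow> 'b::topological_space \<Rightarrow> real"
  assumes "finite A" "A \<noteq> {}" "\<And>i. i \<in> A \<Longrightarrow> continuous_on S (f i)"
  shows "continuous_on S (\<lambda>x. Min ((\<lambda>i. f i x) ` A))"
  using assms
proof (induction A rule: finite_ne_induct)
  case (insert i A)
  then show ?case by (auto intro!: continuous_on_min)
qed simp

lemma continuous_on_sup_abs:
  assumes "finite A" "\<And>i. i \<in> A \<Longrightarrow> continuous_on S (\<lambda>x. f x i)"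
  shows "continuous_on S (\<lambda>x. sup_abs A (f x))"
  using assms
proof (induction A rule: finite_induct)
  case (insert i A)
  have "sup_abs (insert i A) (f x) = max \<bar>f x i\<bar> (sup_abs A (f x))" for x
  proof -
    have "sup_abs (insert i A) (f x) = Max (insert \<bar>f x i\<bar> (insert 0 ((\<lambda>i. \<bar>f x i\<bar>) ` A)))"
      by (simp only: sup_abs_def image_insert insert_commute)
    with insert.hyps(1) show ?thesis by (simp add: sup_abs_def del: insert_iff)
  qed
  then show ?case
    using insert by (auto intro!: continuous_on_max continuous_on_rabs)
qed (simp add: sup_abs_def)

lemma continuous_on_coord: "continuous_on S (\<lambda>x::'i \<Rightarrow> real. x i)"
  by (rule continuous_on_subset[OF continuous_on_product_coordinates]) simp

section \<open>Spheroids on the unit cube\<close>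

lemma topspace_unit_cube: "topspace (unit_cube k) = {..<k} \<rightarrow>\<^sub>E {0..1}"
  by (simp add: unit_cube_def)

lemma continuous_map_into_unit_cube:
  assumes "\<And>j. j < k \<Longrightarrow> continuous_on S (\<lambda>x. g x j)"
    and "\<And>x j. x \<in> S \<Longrightarrow> j < k \<Longrightarrow> 0 \<le> g x j \<and> g x j \<le> 1"
  shows "continuous_map (top_of_set S) (unit_cube k) (\<lambda>x. restrict (g x) {..<k})"
  unfolding unit_cube_def continuous_map_componentwise
  using assms by (auto simp: continuous_map_in_subtopology)

lemma continuous_map_unit_cube_coord:
  "j < k \<Longrightarrow> continuous_map (unit_cube k) euclideanreal (\<lambda>t. t j)"
  using continuous_map_product_projection[of j "{..<k}" "\<lambda>_. top_of_set {0..1::real}"]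
  unfolding unit_cube_def by (auto simp: continuous_map_in_subtopology)

text \<open>The images of \<open>g\<close> and of the constant spheroid under the homotopy relation
  are both the only class. As \<open>g\<close> lies in its own image, it lies in that of the
  constant spheroid, which is a homotopy relative to the boundary.\<close>

lemma spheroid_null_homotopy:
  assumes sing: "is_singleton (homotopy_group k X x0)"
    and g: "g \<in> spheroids k X x0" and x0: "x0 \<in> topspace X"
  obtains h where "continuous_map (prod_topology (top_of_set {0..1::real}) (unit_cube k)) X h"
    "\<And>t. h (0, t) = x0" "\<And>t. h (1, t) = g t"
    "\<And>s t. s \<in> {0..1} \<Longrightarrow> t \<in> unit_cube_boundary k \<Longrightarrow> h (s, t) = x0"
proof -
  let ?R = "spheroid_homotopy k X x0"
  have const: "(\<lambda>_. x0) \<in> spheroids k X x0"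
    using x0 by (simp add: spheroids_def)
  have "?R `` {\<lambda>_. x0} \<in> homotopy_group k X x0" "?R `` {g} \<in> homotopy_group k X x0"
    using const g by (auto simp: homotopy_group_def intro: quotientI)
  then have "?R `` {\<lambda>_. x0} = ?R `` {g}"
    using sing by (auto simp: is_singleton_def)
  moreover have "(g, g) \<in> ?R"
    using g by (auto simp: spheroid_homotopy_def spheroids_def)
  ultimately have "(\<lambda>_. x0, g) \<in> ?R" by blast
  then have "homotopic_with (\<lambda>h. \<forall>t\<in>unit_cube_boundary k. h t = x0) (unit_cube k) X (\<lambda>_. x0) g"
    by (simp add: spheroid_homotopy_def)
  then obtain h where h: "continuous_map (prod_topology (top_of_set {0..1::real}) (unit_cube k)) X h \<and>
      (\<forall>t. h (0, t) = x0) \<and> (\<forall>t. h (1, t) = g t) \<and>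
      (\<forall>s\<in>{0..1}. \<forall>t\<in>unit_cube_boundary k. h (s, t) = x0)"
    unfolding homotopic_with_def by (rule exE)
  show thesis by (rule that[of h]) (use h in auto)
qed

section \<open>Deforming the boundary of a cube towards a pole\<close>

definition disk :: "nat set \<Rightarrow> (nat \<Rightarrow> real) set" where
  "disk A = {z. \<forall>i. if i \<in> A then \<bar>z i\<bar> \<le> 1 else z i = 0}"

definition disk_boundary :: "nat set \<Rightarrow> (nat \<Rightarrow> real) set" where
  "disk_boundary A = {z \<in> disk A. \<exists>i\<in>A. \<bar>z i\<bar> = 1}"

definition punctured :: "nat set \<Rightarrow> (nat \<Rightarrow> real) set" where
  "punctured A = {z. (\<forall>i. i \<notin> A \<longrightarrow> z i = 0) \<and> sup_abs A z \<noteq> 0}"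

text \<open>Projection from the centre onto the boundary. Since \<open>disk A\<close> is the cube
  with coordinates in [-1, 1], its norm is \<open>sup_abs A\<close>.\<close>

definition radial :: "nat set \<Rightarrow> (nat \<Rightarrow> real) \<Rightarrow> nat \<Rightarrow> real" where
  "radial A z = (\<lambda>i. z i / sup_abs A z)"

text \<open>The pole is the unit vector in direction \<open>a\<close>. On the boundary of the cube,
  the weight is 1 on every face except \<open>w a = -1\<close>; on that face it is the sup norm of
  the remaining coordinates, so it vanishes only at the antipode of the pole.\<close>

definition cap_weight :: "nat set \<Rightarrow> nat \<Rightarrow> (nat \<Rightarrow> real) \<Rightarrow> real" where
  "cap_weight A a w = min 1 (sup_abs (A - {a}) w + 1 + w a)"

text \<open>The point on the segment from \<open>w\<close> to the pole at the fraction
  \<open>s * cap_weight A a w\<close>.\<close>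

definition push :: "nat set \<Rightarrow> nat \<Rightarrow> real \<Rightarrow> (nat \<Rightarrow> real) \<Rightarrow> nat \<Rightarrow> real" where
  "push A a s w = (\<lambda>i. (1 - s * cap_weight A a w) * w i + (if i = a then s * cap_weight A a w else 0))"

lemma disk_boundary_iff:
  assumes "finite A"
  shows "z \<in> disk_boundary A \<longleftrightarrow> (\<forall>i. i \<notin> A \<longrightarrow> z i = 0) \<and> sup_abs A z = 1"
proof
  assume z: "z \<in> disk_boundary A"
  then obtain i where "i \<in> A" "\<bar>z i\<bar> = 1" by (auto simp: disk_boundary_def)
  then have "1 \<le> sup_abs A z" using abs_le_sup_abs[OF assms] by metis
  moreover have "sup_abs A z \<le> 1"
    using z by (simp add: sup_abs_le_iff assms disk_boundary_def disk_def)
  ultimately show "(\<forall>i. i \<notin> A \<longrightarrow> z i = 0) \<and> sup_abs A z = 1"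
    using z by (simp add: disk_boundary_def disk_def)
next
  assume z: "(\<forall>i. i \<notin> A \<longrightarrow> z i = 0) \<and> sup_abs A z = 1"
  then have "\<exists>i\<in>A. \<bar>z i\<bar> = 1" using sup_abs_attained[OF assms, of z] by simp
  with z abs_le_sup_abs[OF assms, of _ z] show "z \<in> disk_boundary A"
    by (auto simp: disk_boundary_def disk_def)
qed

lemma radial_in_boundary:
  assumes "finite A" "z \<in> punctured A"
  shows "radial A z \<in> disk_boundary A"
proof -
  have "sup_abs A (\<lambda>i. inverse (sup_abs A z) * z i) = 1"
    using assms by (simp add: sup_abs_scale sup_abs_nonneg punctured_def)
  then have "sup_abs A (radial A z) = 1"
    by (simp add: radial_def divide_inverse mult.commute)
  with assms show ?thesis
    by (simp add: disk_boundary_iff radial_def punctured_def)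
qed

lemma radial_boundary: "finite A \<Longrightarrow> z \<in> disk_boundary A \<Longrightarrow> radial A z = z"
  by (simp add: disk_boundary_iff radial_def)

lemma cap_weight_bounds:
  assumes "finite A" "a \<in> A" "w \<in> disk_boundary A"
  shows "0 \<le> cap_weight A a w" "cap_weight A a w \<le> 1"
proof -
  have "\<bar>w a\<bar> \<le> 1" using assms abs_le_sup_abs[of A a w] by (simp add: disk_boundary_iff)
  moreover have "0 \<le> sup_abs (A - {a}) w" using assms(1) by (simp add: sup_abs_nonneg)
  ultimately show "0 \<le> cap_weight A a w" "cap_weight A a w \<le> 1"
    by (auto simp: cap_weight_def)
qed

lemma cap_weight_eq_1:
  assumes "finite A" "a \<in> A" "w \<in> disk_boundary A" "i \<in> A" "\<bar>w i\<bar> = 1" "i \<noteq> a \<or> w a = 1"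
  shows "cap_weight A a w = 1"
proof -
  have a: "\<bar>w a\<bar> \<le> 1" using assms abs_le_sup_abs[of A a w] by (simp add: disk_boundary_iff)
  have n: "0 \<le> sup_abs (A - {a}) w" using assms(1) by (simp add: sup_abs_nonneg)
  show ?thesis
  proof (cases "i = a")
    case True
    with assms n show ?thesis by (auto simp: cap_weight_def)
  next
    case False
    then have "1 \<le> sup_abs (A - {a}) w"
      using assms abs_le_sup_abs[of "A - {a}" i w] by simp
    with a show ?thesis by (auto simp: cap_weight_def)
  qed
qed

text \<open>The segment from \<open>w\<close> towards the pole meets the centre only if \<open>w\<close> is the antipode of the
  pole, where the weight vanishes.\<close>

lemma push_in_punctured:
  assumes A: "finite A" "a \<in> A" and w: "w \<in> disk_boundary A" and s: "0 \<le> s" "s \<le> 1"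
  shows "push A a s w \<in> punctured A"
proof -
  define \<tau> where "\<tau> = s * cap_weight A a w"
  have \<tau>: "0 \<le> \<tau>" "\<tau> \<le> 1"
    using cap_weight_bounds[OF A w] s by (auto simp: \<tau>_def mult_le_one)
  have "sup_abs A (push A a s w) \<noteq> 0"
  proof
    assume "sup_abs A (push A a s w) = 0"
    then have zero: "push A a s w i = 0" if "i \<in> A" for i
      using abs_le_sup_abs[OF A(1) that, of "push A a s w"] by simp
    have za: "(1 - \<tau>) * w a + \<tau> = 0"
      using zero[OF A(2)] by (simp add: push_def \<tau>_def)
    then have "\<tau> \<noteq> 1" by auto
    with \<tau> have lt: "\<tau> < 1" by simp
    have z: "w i = 0" if "i \<in> A" "i \<noteq> a" for i
      using zero[OF that(1)] that(2) \<open>\<tau> \<noteq> 1\<close> by (simp add: push_def \<tau>_def)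
    then have n0: "sup_abs (A - {a}) w = 0"
      using A(1) by (intro antisym) (auto simp: sup_abs_le_iff sup_abs_nonneg)
    have "\<exists>i\<in>A. \<bar>w i\<bar> = 1" using w by (simp add: disk_boundary_def)
    with z have "\<bar>w a\<bar> = 1" by force
    then consider "w a = 1" | "w a = -1" by linarith
    then show False
    proof cases
      case 1
      with za show False by simp
    next
      case 2
      then have "\<tau> = 0" by (simp add: \<tau>_def cap_weight_def n0)
      with za 2 show False by simp
    qed
  qed
  with A w show ?thesis
    by (auto simp: punctured_def push_def disk_boundary_iff)
qed

lemma continuous_on_radial:
  assumes "finite A" "continuous_on S f" "f ` S \<subseteq> punctured A"
  shows "continuous_on S (\<lambda>x. radial A (f x))"
proof (rule continuous_on_coordinatewise_then_product)
  fix i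
  have c: "continuous_on S (\<lambda>x. f x i)" for i
    using assms(2) by (rule continuous_on_product_then_coordinatewise)
  show "continuous_on S (\<lambda>x. radial A (f x) i)"
    unfolding radial_def using assms(1,3)
    by (intro continuous_on_divide c continuous_on_sup_abs) (auto simp: punctured_def)
qed

lemma continuous_on_push:
  assumes "finite A" "continuous_on S f" "continuous_on S s"
  shows "continuous_on S (\<lambda>x. push A a (s x) (f x))"
proof (rule continuous_on_coordinatewise_then_product)
  fix i
  have c: "continuous_on S (\<lambda>x. f x i)" for i
    using assms(2) by (rule continuous_on_product_then_coordinatewise)
  have w: "continuous_on S (\<lambda>x. cap_weight A a (f x))"
    unfolding cap_weight_def using assms(1)
    by (intro continuous_on_min continuous_on_add continuous_on_const c continuous_on_sup_abs) auto
  show "continuous_on S (\<lambda>x. push A a (s x) (f x) i)"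
    unfolding push_def
    by (cases "i = a") (auto intro!: continuous_intros c w assms(3))
qed

text \<open>All faces but \<open>w a = -1\<close> are sent to \<open>x0\<close>, so \<open>f\<close>
  on that face is a spheroid. Its null homotopy, run along the axis \<open>a\<close>, fills the cube
  and takes the value \<open>x0\<close> on the side faces and on the face through the pole.\<close>

lemma extend_if_constant_on_cap:
  assumes A: "finite A" "a \<in> A" and b: "bij_betw b {..<k} (A - {a})"
    and sing: "is_singleton (homotopy_group k X x0)" and x0: "x0 \<in> topspace X"
    and f: "continuous_map (top_of_set (disk_boundary A)) X f"
    and f0: "\<And>w. w \<in> disk_boundary A \<Longrightarrow> cap_weight A a w = 1 \<Longrightarrow> f w = x0"
  obtains g where "continuous_map (top_of_set (disk A)) X g"
    "\<And>w. w \<in> disk_boundary A \<Longrightarrow> g w = f w"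
proof -
  define c where "c = the_inv_into {..<k} b"
  \<comment> \<open>\<open>\<iota>\<close> parametrizes the face \<open>w a = -1\<close> by the unit
    cube, the axes being numbered by \<open>b\<close> with inverse \<open>c\<close>;
    \<open>\<kappa>\<close> forgets the axis \<open>a\<close> and rescales back.\<close>
  define \<iota> where "\<iota> t i = (if i = a then -1 else if i \<in> A then 2 * t (c i) - 1 else 0)"
    for t :: "nat \<Rightarrow> real" and i
  define \<kappa> where "\<kappa> z = restrict (\<lambda>j. (1 + z (b j)) / 2) {..<k}" for z :: "nat \<Rightarrow> real"
  have bA: "b j \<in> A" "b j \<noteq> a" if "j < k" for j
    using b that by (auto simp: bij_betw_def)
  have c: "c i < k" "b (c i) = i" if "i \<in> A" "i \<noteq> a" for i
    using b that f_the_inv_into_f_bij_betw[OF b] the_inv_into_into[of b "{..<k}" i "{..<k}"]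
    by (auto simp: c_def bij_betw_def)
  have cb: "c (b j) = j" if "j < k" for j
    using b that by (auto simp: c_def bij_betw_def the_inv_into_f_f)
  have \<iota>_bd: "\<iota> t \<in> disk_boundary A" if "t \<in> topspace (unit_cube k)" for t
  proof -
    have "\<bar>2 * t (c i) - 1\<bar> \<le> 1" if "i \<in> A" "i \<noteq> a" for i
    proof -
      have "t (c i) \<in> {0..1}"
        using \<open>t \<in> topspace (unit_cube k)\<close> c(1)[OF that] unfolding topspace_unit_cube by blast
      then show ?thesis by (simp add: abs_le_iff)
    qed
    then show ?thesis
      using A by (auto simp: disk_boundary_def disk_def \<iota>_def)
  qed
  have "continuous_map (unit_cube k) euclideanreal (\<lambda>t. \<iota> t i)" for i
    using c by (auto simp: \<iota>_def intro!: continuous_intros continuous_map_unit_cube_coord)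
  then have "continuous_map (unit_cube k) (product_topology (\<lambda>_. euclideanreal) UNIV) \<iota>"
    by (simp add: continuous_map_componentwise_UNIV)
  then have "continuous_map (unit_cube k) (top_of_set (disk_boundary A)) \<iota>"
    using \<iota>_bd by (auto simp: euclidean_product_topology continuous_map_in_subtopology)
  then have "continuous_map (unit_cube k) X (f \<circ> \<iota>)"
    by (rule continuous_map_compose[OF _ f])
  moreover have "(f \<circ> \<iota>) t = x0" if t: "t \<in> unit_cube_boundary k" for t
  proof -
    obtain j where j: "j < k" "t j = 0 \<or> t j = 1" and tt: "t \<in> topspace (unit_cube k)"
      using t by (auto simp: unit_cube_boundary_def)
    have "\<bar>\<iota> t (b j)\<bar> = 1" using j bA[OF j(1)] cb[OF j(1)] by (auto simp: \<iota>_def)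
    then show ?thesis
      using f0[OF \<iota>_bd[OF tt] cap_weight_eq_1[OF A \<iota>_bd[OF tt] bA(1)[OF j(1)]]] bA(2)[OF j(1)] by simp
  qed
  ultimately have sph: "f \<circ> \<iota> \<in> spheroids k X x0" by (simp add: spheroids_def)
  obtain h where h: "continuous_map (prod_topology (top_of_set {0..1::real}) (unit_cube k)) X h"
    and h0: "\<And>t. h (0, t) = x0" and h1: "\<And>t. h (1, t) = (f \<circ> \<iota>) t"
    and hb: "\<And>s t. s \<in> {0..1} \<Longrightarrow> t \<in> unit_cube_boundary k \<Longrightarrow> h (s, t) = x0"
    using spheroid_null_homotopy[OF sing sph x0] by metis
  have \<kappa>01: "0 \<le> (1 + z (b j)) / 2 \<and> (1 + z (b j)) / 2 \<le> 1" if "z \<in> disk A" "j < k" for z j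
  proof -
    have "\<bar>z (b j)\<bar> \<le> 1" using that bA[OF that(2)] by (simp add: disk_def)
    then show ?thesis by (simp add: abs_le_iff)
  qed
  have za: "\<bar>z a\<bar> \<le> 1" if "z \<in> disk A" for z
    using that A by (simp add: disk_def)
  have "continuous_map (top_of_set (disk A)) (unit_cube k) \<kappa>"
    unfolding \<kappa>_def using \<kappa>01
    by (intro continuous_map_into_unit_cube) (auto intro!: continuous_intros continuous_on_coord)
  moreover have "continuous_map (top_of_set (disk A)) (top_of_set {0..1::real}) (\<lambda>z. (1 - z a) / 2)"
    using za by (force simp: continuous_map_in_subtopology abs_le_iff
        intro!: continuous_intros continuous_on_coord)
  \<comment> \<open>The time \<open>(1 - z a) / 2\<close> is 1 on the face \<open>z a = -1\<close>,
    where \<open>h\<close> is the spheroid, and 0 on the opposite face, where \<open>h\<close> is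
    constant.\<close>
  ultimately have "continuous_map (top_of_set (disk A)) X (h \<circ> (\<lambda>z. ((1 - z a) / 2, \<kappa> z)))"
    by (intro continuous_map_compose[OF _ h]) (simp add: continuous_map_pairedI)
  moreover have "(h \<circ> (\<lambda>z. ((1 - z a) / 2, \<kappa> z))) w = f w" if w: "w \<in> disk_boundary A" for w
  proof -
    have wd: "w \<in> disk A" using w by (simp add: disk_boundary_def)
    obtain i where i: "i \<in> A" "\<bar>w i\<bar> = 1" using w by (auto simp: disk_boundary_def)
    consider "i \<noteq> a" | "i = a" "w a = 1" | "i = a" "w a = -1"
      using i(2) by (auto simp: abs_if split: if_splits)
    then show ?thesis
    proof cases
      case 1
      have "\<kappa> w \<in> topspace (unit_cube k)"
        using \<kappa>01[OF wd] by (auto simp: topspace_unit_cube \<kappa>_def)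
      moreover have "\<kappa> w (c i) = 0 \<or> \<kappa> w (c i) = 1"
        using c[OF i(1) 1] i(2) by (auto simp: \<kappa>_def abs_if split: if_splits)
      ultimately have "\<kappa> w \<in> unit_cube_boundary k"
        using c[OF i(1) 1] by (auto simp: unit_cube_boundary_def)
      moreover have "(1 - w a) / 2 \<in> {0..1}" using za[OF wd] by (simp add: abs_le_iff)
      ultimately show ?thesis
        using hb f0[OF w cap_weight_eq_1[OF A w i]] 1 by simp
    next
      case 2
      then show ?thesis
        using h0 f0[OF w cap_weight_eq_1[OF A w i]] by simp
    next
      case 3
      have "\<iota> (\<kappa> w) i = w i" for i
      proof -
        consider "i = a" | "i \<in> A" "i \<noteq> a" | "i \<notin> A" by blast
        then show ?thesis
        proof cases
          case 1
          with 3 show ?thesis by (simp add: \<iota>_def)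
        next
          case 2
          then show ?thesis using c[OF 2] by (simp add: \<iota>_def \<kappa>_def field_simps)
        next
          case 3
          then show ?thesis using wd A by (auto simp: \<iota>_def disk_def)
        qed
      qed
      then have "\<iota> (\<kappa> w) = w" by blast
      with 3 h1 show ?thesis by simp
    qed
  qed
  ultimately show thesis by (rule that)
qed

text \<open>In the collar \<open>1/2 \<le> sup_abs A z\<close> the boundary is deformed until all faces but one sit at the
  pole; the remaining face then carries a spheroid, whose null homotopy fills the inner cube.\<close>

lemma disk_extension:
  assumes A: "finite A" "a \<in> A" and b: "bij_betw b {..<k} (A - {a})"
    and sing: "\<And>x0. x0 \<in> topspace X \<Longrightarrow> is_singleton (homotopy_group k X x0)"
    and f: "continuous_map (top_of_set (disk_boundary A)) X f"
  obtains g where "continuous_map (top_of_set (disk A)) X g"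
    "\<And>w. w \<in> disk_boundary A \<Longrightarrow> g w = f w"
proof -
  let ?e = "\<lambda>i. if i = a then 1 else 0 :: real"
  have e: "?e \<in> disk_boundary A"
    using A by (auto simp: disk_boundary_def disk_def)
  have fe: "f ?e \<in> topspace X"
    using continuous_map_image_subset_topspace[OF f] e by auto
  \<comment> \<open>The final stage of the deformation: a point of weight 1 is moved all the way to
    the pole \<open>?e\<close>, so \<open>f1\<close> meets the constancy assumption with base point
    \<open>f ?e\<close>.\<close>
  define f1 where "f1 w = f (radial A (push A a 1 w))" for w
  have comp: "continuous_map (top_of_set S) X (\<lambda>x. f (radial A (push A a (s x) (u x))))"
    if "continuous_on S u" "continuous_on S s" "\<And>x. x \<in> S \<Longrightarrow> u x \<in> disk_boundary A"
      "\<And>x. x \<in> S \<Longrightarrow> 0 \<le> s x \<and> s x \<le> 1" for S s and u :: "(nat \<Rightarrow> real) \<Rightarrow> nat \<Rightarrow> real"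
  proof -
    have P: "push A a (s x) (u x) \<in> punctured A" if "x \<in> S" for x
      using push_in_punctured[OF A] that \<open>\<And>x. x \<in> S \<Longrightarrow> u x \<in> disk_boundary A\<close>
        \<open>\<And>x. x \<in> S \<Longrightarrow> 0 \<le> s x \<and> s x \<le> 1\<close> by blast
    have "continuous_on S (\<lambda>x. radial A (push A a (s x) (u x)))"
      using P by (intro continuous_on_radial continuous_on_push A that) auto
    then have "continuous_map (top_of_set S) (top_of_set (disk_boundary A))
        (\<lambda>x. radial A (push A a (s x) (u x)))"
      using radial_in_boundary[OF A(1) P] by (auto simp: continuous_map_in_subtopology)
    from continuous_map_compose[OF this f] show ?thesis by (simp add: o_def)
  qed
  have "continuous_map (top_of_set (disk_boundary A)) X f1"
    unfolding f1_def by (rule comp) auto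
  moreover have "f1 w = f ?e" if "w \<in> disk_boundary A" "cap_weight A a w = 1" for w
  proof -
    have "push A a 1 w = ?e" using that(2) by (auto simp: push_def)
    then show ?thesis by (simp add: f1_def radial_boundary[OF A(1) e])
  qed
  ultimately obtain g1 where g1: "continuous_map (top_of_set (disk A)) X g1"
    and g1f: "\<And>w. w \<in> disk_boundary A \<Longrightarrow> g1 w = f1 w"
    using extend_if_constant_on_cap[OF A b sing[OF fe] fe] by metis
  define inner where "inner z = g1 (\<lambda>i. 2 * z i)" for z
  \<comment> \<open>The time \<open>2 - 2 * sup_abs A z\<close> is 1 on the inner wall of the
    collar, where the value is that of \<open>f1\<close>, and 0 on the boundary, where it is that of
    \<open>f\<close>.\<close>
  define outer where "outer z = f (radial A (push A a (2 - 2 * sup_abs A z) (radial A z)))" for z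
  have dpunct: "z \<in> punctured A" if "z \<in> disk A" "1/2 \<le> sup_abs A z" for z
    using that by (auto simp: punctured_def disk_def)
  have sup1: "sup_abs A z \<le> 1" if "z \<in> disk A" for z
    using that A(1) by (simp add: sup_abs_le_iff disk_def)
  have sup_cont: "continuous_on S (sup_abs A)" for S
    by (rule continuous_on_sup_abs[OF A(1)]) (rule continuous_on_coord)
  have "continuous_map (top_of_set (disk A)) X (\<lambda>z. if sup_abs A z \<le> 1/2 then inner z else outer z)"
  proof (rule continuous_map_cases_le)
    show "continuous_map (top_of_set (disk A)) euclideanreal (sup_abs A)"
      using sup_cont by simp
    show "continuous_map (top_of_set (disk A)) euclideanreal (\<lambda>z. 1/2)" by simp
    let ?S = "{z \<in> topspace (top_of_set (disk A)). sup_abs A z \<le> 1/2}"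
    have "(\<lambda>i. 2 * z i) \<in> disk A" if "z \<in> ?S" for z
    proof -
      have "\<bar>z i\<bar> \<le> 1/2" if "i \<in> A" for i
        using abs_le_sup_abs[OF A(1) that, of z] \<open>z \<in> ?S\<close> by simp
      with that show ?thesis by (force simp: disk_def abs_mult)
    qed
    then have "continuous_map (subtopology (top_of_set (disk A)) ?S) (top_of_set (disk A)) (\<lambda>z i. 2 * z i)"
      by (auto simp: subtopology_subtopology continuous_map_in_subtopology
          intro!: continuous_on_coordinatewise_then_product continuous_intros continuous_on_coord)
    from continuous_map_compose[OF this g1]
    show "continuous_map (subtopology (top_of_set (disk A)) ?S) X inner"
      by (simp add: o_def inner_def[abs_def])
    let ?T = "{z \<in> topspace (top_of_set (disk A)). 1/2 \<le> sup_abs A z}"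
    have "continuous_map (top_of_set ?T) X outer"
      unfolding outer_def[abs_def]
    proof (rule comp)
      show "continuous_on ?T (radial A)"
        using dpunct continuous_on_radial[OF A(1) continuous_on_id, of ?T] by auto
      show "continuous_on ?T (\<lambda>z. 2 - 2 * sup_abs A z)"
        by (intro continuous_intros sup_cont)
      show "radial A z \<in> disk_boundary A" if "z \<in> ?T" for z
        using that dpunct by (intro radial_in_boundary A(1)) auto
      show "0 \<le> 2 - 2 * sup_abs A z \<and> 2 - 2 * sup_abs A z \<le> 1" if "z \<in> ?T" for z
        using that sup1 by auto
    qed
    moreover have "disk A \<inter> ?T = ?T" by auto
    ultimately show "continuous_map (subtopology (top_of_set (disk A)) ?T) X outer"
      by (simp only: subtopology_subtopology)
    fix z assume z: "z \<in> topspace (top_of_set (disk A))" "sup_abs A z = 1/2"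
    have rz: "radial A z = (\<lambda>i. 2 * z i)" unfolding radial_def z(2) by (simp add: mult.commute)
    have "(\<lambda>i. 2 * z i) \<in> disk_boundary A"
      using radial_in_boundary[OF A(1) dpunct, of z] z rz by simp
    moreover have "2 - 2 * sup_abs A z = 1" using z(2) by simp
    ultimately show "inner z = outer z"
      by (simp only: inner_def outer_def g1f f1_def rz)
  qed
  moreover have "(if sup_abs A w \<le> 1/2 then inner w else outer w) = f w" if w: "w \<in> disk_boundary A" for w
  proof -
    have "sup_abs A w = 1" using w by (simp add: disk_boundary_iff A(1))
    moreover have "push A a 0 w = w" by (auto simp: push_def)
    ultimately show ?thesis
      using w by (simp add: outer_def radial_boundary[OF A(1)])
  qed
  ultimately show thesis by (rule that)
qed

section \<open>Extension over the cubes of the integer grid\<close>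

definition grid_cube :: "(nat \<Rightarrow> nat) \<Rightarrow> nat set \<Rightarrow> (nat \<Rightarrow> real) set" where
  "grid_cube q A = {x. \<forall>i. if i \<in> A then real (q i) \<le> x i \<and> x i \<le> real (q i) + 1 else x i = real (q i)}"

definition grid_cube_boundary :: "(nat \<Rightarrow> nat) \<Rightarrow> nat set \<Rightarrow> (nat \<Rightarrow> real) set" where
  "grid_cube_boundary q A = {x \<in> grid_cube q A. \<exists>i\<in>A. x i = real (q i) \<or> x i = real (q i) + 1}"

lemma closed_grid_cube: "closed (grid_cube q A)"
proof -
  have "grid_cube q A = (\<Inter>i. {x. if i \<in> A then real (q i) \<le> x i \<and> x i \<le> real (q i) + 1 else x i = real (q i)})"
    by (auto simp: grid_cube_def)
  moreover have "closed {x :: nat \<Rightarrow> real. if i \<in> A then real (q i) \<le> x i \<and> x i \<le> real (q i) + 1 else x i = real (q i)}" for i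
    by (cases "i \<in> A") (auto intro!: closed_Collect_conj closed_Collect_le closed_Collect_eq continuous_on_coord continuous_intros)
  ultimately show ?thesis by (metis (no_types, lifting) closed_INT)
qed

text \<open>An affine change of coordinates turns the grid cube into \<open>disk A\<close>. One axis
  \<open>a\<close> is reserved for the pole; the other \<open>k\<close> axes carry the spheroid,
  which is why degree \<open>k\<close> controls a cube of dimension \<open>k + 1\<close>.\<close>

lemma grid_cube_extension_pos:
  assumes A: "finite A" "card A = Suc k" and k: "0 < k" and pi: "pi_trivial (int k) X"
    and f: "continuous_map (top_of_set (grid_cube_boundary q A)) X f"
  obtains g where "continuous_map (top_of_set (grid_cube q A)) X g"
    "\<And>x. x \<in> grid_cube_boundary q A \<Longrightarrow> g x = f x"
proof -
  have sing: "is_singleton (homotopy_group k X x0)" if "x0 \<in> topspace X" for x0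
    using pi k that by (simp add: pi_trivial_def)
  obtain a where a: "a \<in> A" using A by (cases "A = {}") auto
  have "card (A - {a}) = k" using A a by simp
  then obtain b where b: "bij_betw b {..<k} (A - {a})"
    using A(1) by (metis atLeast0LessThan ex_bij_betw_nat_finite finite_Diff)
  define to_cube where "to_cube z i = (if i \<in> A then real (q i) + (1 + z i) / 2 else real (q i))"
    for z :: "nat \<Rightarrow> real" and i
  define to_disk where "to_disk x i = (if i \<in> A then 2 * (x i - real (q i)) - 1 else 0)"
    for x :: "nat \<Rightarrow> real" and i
  have "continuous_on S to_cube" for S
  proof (rule continuous_on_coordinatewise_then_product)
    show "continuous_on S (\<lambda>x. to_cube x i)" for i
      by (cases "i \<in> A") (auto simp: to_cube_def intro!: continuous_intros continuous_on_coord)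
  qed
  moreover have tc: "to_cube z \<in> grid_cube_boundary q A" if "z \<in> disk_boundary A" for z
  proof -
    have "\<bar>z i\<bar> \<le> 1" if "i \<in> A" for i
      using \<open>z \<in> disk_boundary A\<close> that by (auto simp: disk_boundary_def disk_def split: if_splits)
    then have "real (q i) \<le> to_cube z i \<and> to_cube z i \<le> real (q i) + 1" if "i \<in> A" for i
      using that by (force simp: to_cube_def abs_le_iff field_simps)
    moreover obtain i where i: "i \<in> A" "\<bar>z i\<bar> = 1"
      using \<open>z \<in> disk_boundary A\<close> by (auto simp: disk_boundary_def)
    then have "to_cube z i = real (q i) \<or> to_cube z i = real (q i) + 1"
      by (auto simp: to_cube_def abs_if split: if_splits)
    ultimately show ?thesis
      using i by (auto simp: grid_cube_boundary_def grid_cube_def to_cube_def)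
  qed
  ultimately have "continuous_map (top_of_set (disk_boundary A)) (top_of_set (grid_cube_boundary q A)) to_cube"
    by (auto simp: continuous_map_in_subtopology)
  then have "continuous_map (top_of_set (disk_boundary A)) X (f \<circ> to_cube)"
    by (rule continuous_map_compose[OF _ f])
  then obtain g where g: "continuous_map (top_of_set (disk A)) X g"
    and gf: "\<And>w. w \<in> disk_boundary A \<Longrightarrow> g w = (f \<circ> to_cube) w"
    using disk_extension[OF A(1) a b sing] by metis
  have "continuous_on S to_disk" for S
  proof (rule continuous_on_coordinatewise_then_product)
    show "continuous_on S (\<lambda>x. to_disk x i)" for i
      by (cases "i \<in> A") (auto simp: to_disk_def intro!: continuous_intros continuous_on_coord)
  qed
  moreover have td: "to_disk x \<in> disk A" if "x \<in> grid_cube q A" for x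
  proof -
    have "\<bar>to_disk x i\<bar> \<le> 1" if "i \<in> A" for i
    proof -
      have "real (q i) \<le> x i \<and> x i \<le> real (q i) + 1"
        using \<open>x \<in> grid_cube q A\<close> that by (auto simp: grid_cube_def)
      with that show ?thesis by (simp add: to_disk_def abs_le_iff)
    qed
    then show ?thesis by (auto simp: disk_def to_disk_def)
  qed
  ultimately have "continuous_map (top_of_set (grid_cube q A)) (top_of_set (disk A)) to_disk"
    by (auto simp: continuous_map_in_subtopology)
  then have "continuous_map (top_of_set (grid_cube q A)) X (g \<circ> to_disk)"
    by (rule continuous_map_compose[OF _ g])
  moreover have "(g \<circ> to_disk) x = f x" if x: "x \<in> grid_cube_boundary q A" for x
  proof -
    have xc: "x \<in> grid_cube q A" using x by (simp add: grid_cube_boundary_def)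
    then have "to_cube (to_disk x) i = x i" for i
      by (auto simp: to_cube_def to_disk_def grid_cube_def diff_divide_distrib split: if_splits)
    then have "to_cube (to_disk x) = x" by blast
    moreover obtain i where i: "i \<in> A" "x i = real (q i) \<or> x i = real (q i) + 1"
      using x by (auto simp: grid_cube_boundary_def)
    then have "\<bar>to_disk x i\<bar> = 1" by (auto simp: to_disk_def)
    then have "to_disk x \<in> disk_boundary A"
      using td[OF xc] i(1) by (auto simp: disk_boundary_def)
    ultimately show ?thesis using gf by simp
  qed
  ultimately show thesis by (rule that)
qed

text \<open>The boundary is a sphere of dimension \<open>card A - 1\<close>. The three meanings of
  \<open>pi_trivial\<close> match the cases: a point needs a value, an edge needs a path between the
  values at its ends, and larger cubes need a null homotopy.\<close>

lemma grid_cube_extension: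
  assumes A: "finite A" and pi: "pi_trivial (int (card A) - 1) X"
    and f: "continuous_map (top_of_set (grid_cube_boundary q A)) X f"
  shows "\<exists>g. continuous_map (top_of_set (grid_cube q A)) X g \<and>
    (\<forall>x\<in>grid_cube_boundary q A. g x = f x)"
proof -
  consider "card A = 0" | "card A = 1" | k where "card A = Suc k" "0 < k"
    by (metis One_nat_def neq0_conv not0_implies_Suc)
  then show ?thesis
  proof cases
    case 1
    then have "A = {}" using A by simp
    moreover obtain y where "y \<in> topspace X" using pi 1 by (auto simp: pi_trivial_def simp del: topspace_discrete_topology null_topspace_iff_trivial)
    ultimately show ?thesis by (intro exI[of _ "\<lambda>_. y"]) (auto simp: grid_cube_boundary_def)
  next
    case 2
    then obtain a where a: "A = {a}" by (auto simp: card_1_singleton_iff)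
    \<comment> \<open>\<open>u s\<close> is the point of the edge at distance \<open>s\<close> from
      its lower end.\<close>
    define u where "u s i = real (q i) + (if i = a then s else 0)" for s i
    have u: "u 0 \<in> grid_cube_boundary q A" "u 1 \<in> grid_cube_boundary q A"
      by (auto simp: grid_cube_boundary_def grid_cube_def a u_def)
    then have "f (u 0) \<in> topspace X" "f (u 1) \<in> topspace X"
      using continuous_map_image_subset_topspace[OF f] by auto
    moreover have "path_connected_space X" using pi 2 by (simp add: pi_trivial_def)
    ultimately obtain g where g: "pathin X g" "g 0 = f (u 0)" "g 1 = f (u 1)"
      unfolding path_connected_space_def by blast
    have "continuous_map (top_of_set (grid_cube q A)) (top_of_set {0..1}) (\<lambda>x. x a - real (q a))"
      by (force simp: continuous_map_in_subtopology grid_cube_def a intro!: continuous_intros continuous_on_coord)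
    from continuous_map_compose[OF this g(1)[unfolded pathin_def]]
    have "continuous_map (top_of_set (grid_cube q A)) X (g \<circ> (\<lambda>x. x a - real (q a)))" .
    moreover have "(g \<circ> (\<lambda>x. x a - real (q a))) x = f x" if x: "x \<in> grid_cube_boundary q A" for x
    proof -
      have "x = u (x a - real (q a))"
      proof
        show "x i = u (x a - real (q a)) i" for i
          using x by (cases "i = a") (auto simp: grid_cube_boundary_def grid_cube_def a u_def split: if_splits)
      qed
      moreover have "x a - real (q a) = 0 \<or> x a - real (q a) = 1"
        using x by (auto simp: grid_cube_boundary_def a)
      ultimately show ?thesis using g(2,3) by (metis comp_apply)
    qed
    ultimately show ?thesis by blast
  next
    case 3
    then have "pi_trivial (int k) X" using pi by simp
    then show ?thesis using grid_cube_extension_pos[OF A 3 _ f] by metis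
  qed
qed

section \<open>Maps on the integer grid\<close>

text \<open>Off the boundary, the free coordinates lie strictly between consecutive integers and the
  others are integers, so the point determines its cube. This makes a definition of a map by cases
  over cubes unambiguous.\<close>

lemma grid_cube_interior:
  assumes "x \<in> grid_cube q A" "x \<notin> grid_cube_boundary q A"
  shows "{i. x i \<notin> \<int>} = A" "(\<lambda>i. nat \<lfloor>x i\<rfloor>) = q"
proof -
  have in_A: "real (q i) < x i \<and> x i < real (q i) + 1" if "i \<in> A" for i
  proof -
    have "real (q i) \<le> x i" "x i \<le> real (q i) + 1"
      using assms(1) that by (auto simp: grid_cube_def)
    moreover have "x i \<noteq> real (q i)" "x i \<noteq> real (q i) + 1"
      using assms that by (auto simp: grid_cube_boundary_def)
    ultimately show ?thesis by simp
  qed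
  have notin_A: "x i = real (q i)" if "i \<notin> A" for i
    using assms(1) that by (auto simp: grid_cube_def)
  have "x i \<notin> \<int>" if "i \<in> A" for i
  proof
    assume "x i \<in> \<int>"
    then obtain z where "x i = real_of_int z" by (auto elim: Ints_cases)
    with in_A[OF that] have "int (q i) < z" "z < int (q i) + 1" by linarith+
    then show False by simp
  qed
  moreover have "x i \<in> \<int>" if "i \<notin> A" for i
    using notin_A[OF that] by simp
  ultimately show "{i. x i \<notin> \<int>} = A" by blast
  show "(\<lambda>i. nat \<lfloor>x i\<rfloor>) = q"
  proof
    show "nat \<lfloor>x i\<rfloor> = q i" for i
    proof (cases "i \<in> A")
      case True
      then have "\<lfloor>x i\<rfloor> = int (q i)" using in_A[OF True] by (intro floor_unique) auto
      then show ?thesis by simp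
    qed (simp add: notin_A)
  qed
qed

lemma grid_cube_nonint_subset: "x \<in> grid_cube q A \<Longrightarrow> {i. x i \<notin> \<int>} \<subseteq> A"
  by (auto simp: grid_cube_def) (metis Ints_of_nat)

text \<open>Some free coordinate has become an integer, so the point belongs to a lower
  skeleton.\<close>

lemma grid_cube_boundary_nonint_psubset:
  assumes "x \<in> grid_cube_boundary q A"
  shows "{i. x i \<notin> \<int>} \<subset> A"
proof -
  obtain i where i: "i \<in> A" "x i = real (q i) \<or> x i = real (q i) + 1"
    using assms by (auto simp: grid_cube_boundary_def)
  have "x i \<in> \<int>" using i(2) by auto
  with i(1) grid_cube_nonint_subset[of x q A] assms show ?thesis
    by (auto simp: grid_cube_boundary_def)
qed

text \<open>Freezing a free direction \<open>i\<close> at its lower (\<open>e = 0\<close>) or upper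
  (\<open>e = 1\<close>) end gives a facet that is again a grid cube, which lets the induction over
  skeleta apply to it.\<close>

lemma grid_cube_boundary_faces:
  "grid_cube_boundary q A = (\<Union>(i, e)\<in>A \<times> {0, 1}. grid_cube (q(i := q i + e)) (A - {i}))"
proof
  show "grid_cube_boundary q A \<subseteq> (\<Union>(i, e)\<in>A \<times> {0, 1}. grid_cube (q(i := q i + e)) (A - {i}))"
  proof
    fix x assume x: "x \<in> grid_cube_boundary q A"
    then obtain i where i: "i \<in> A" "x i = real (q i) \<or> x i = real (q i) + 1"
      by (auto simp: grid_cube_boundary_def)
    then obtain e :: nat where e: "e \<in> {0, 1}" "x i = real (q i + e)" by force
    have "x \<in> grid_cube (q(i := q i + e)) (A - {i})"
      using x e by (auto simp: grid_cube_boundary_def grid_cube_def)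
    with i e show "x \<in> (\<Union>(i, e)\<in>A \<times> {0, 1}. grid_cube (q(i := q i + e)) (A - {i}))" by blast
  qed
  have "x \<in> grid_cube_boundary q A"
    if i: "i \<in> A" "e \<in> {0, 1}" and x: "x \<in> grid_cube (q(i := q i + e)) (A - {i})" for x i and e :: nat
  proof -
    have xi: "x i = real (q i + e)" using x by (simp add: grid_cube_def)
    have "if j \<in> A then real (q j) \<le> x j \<and> x j \<le> real (q j) + 1 else x j = real (q j)" for j
    proof (cases "j = i")
      case False
      then show ?thesis using x by (auto simp: grid_cube_def split: if_splits)
    qed (use xi i in auto)
    with xi i show ?thesis by (auto simp: grid_cube_boundary_def grid_cube_def)
  qed
  then show "(\<Union>(i, e)\<in>A \<times> {0, 1}. grid_cube (q(i := q i + e)) (A - {i})) \<subseteq> grid_cube_boundary q A"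
    by blast
qed

lemma continuous_map_finite_closed_cover:
  assumes "finite I" "\<And>i. i \<in> I \<Longrightarrow> closed (T i)" "S = (\<Union>i\<in>I. T i)"
    "\<And>i. i \<in> I \<Longrightarrow> continuous_map (top_of_set (T i)) X f"
  shows "continuous_map (top_of_set S) X f"
proof (rule pasting_lemma_closed[OF assms(1)])
  show "closedin (top_of_set S) (T i)" if "i \<in> I" for i
    using assms(2,3) that by (intro closed_subset) auto
  show "continuous_map (subtopology (top_of_set S) (T i)) X f" if "i \<in> I" for i
  proof -
    have "S \<inter> T i = T i" using that assms(3) by auto
    with assms(4)[OF that] show ?thesis by (simp add: subtopology_subtopology)
  qed
qed (use assms(3) in auto)

text \<open>The map is built on the skeleta of the integer grid. A point lies in the interior of exactly
  one cube, which is read off from the integral parts of its coordinates.\<close>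

lemma grid_map_exists:
  assumes mono: "\<And>q A i e. A \<subseteq> {..<n} \<Longrightarrow> i \<in> A \<Longrightarrow> e \<in> {0, 1} \<Longrightarrow>
        Z (q(i := q i + e)) (A - {i}) \<subseteq> Z q A"
    and pi: "\<And>q A. A \<subseteq> {..<n} \<Longrightarrow> pi_trivial (int (card A) - 1) (realization (Z q A))"
  shows "\<exists>G. \<forall>q A. A \<subseteq> {..<n} \<longrightarrow>
    continuous_map (top_of_set (grid_cube q A)) (realization (Z q A)) G"
proof -
  have "\<exists>G. \<forall>q A. A \<subseteq> {..<n} \<and> card A < k \<longrightarrow>
      continuous_map (top_of_set (grid_cube q A)) (realization (Z q A)) G" for k
  proof (induction k)
    case (Suc k)
    then obtain G where G: "\<And>q A. A \<subseteq> {..<n} \<Longrightarrow> card A < k \<Longrightarrow>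
      continuous_map (top_of_set (grid_cube q A)) (realization (Z q A)) G" by blast
    have "\<exists>g. A \<subseteq> {..<n} \<and> card A = k \<longrightarrow>
        continuous_map (top_of_set (grid_cube q A)) (realization (Z q A)) g \<and>
        (\<forall>x\<in>grid_cube_boundary q A. g x = G x)" for q A
    proof (cases "A \<subseteq> {..<n} \<and> card A = k")
      case True
      then have fin: "finite A" using finite_subset by blast
      \<comment> \<open>On each facet \<open>G\<close> takes values in the complex of that facet,
        which \<open>mono\<close> places inside \<open>Z q A\<close>; the facets are then pasted
        together.\<close>
      have "continuous_map (top_of_set (grid_cube_boundary q A)) (realization (Z q A)) G"
      proof (rule continuous_map_finite_closed_cover)
        show "finite (A \<times> {0, 1::nat})" using fin by simp
        show "grid_cube_boundary q A =
            (\<Union>ie\<in>A \<times> {0, 1}. case ie of (i, e) \<Rightarrow> grid_cube (q(i := q i + e)) (A - {i}))"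
          by (rule grid_cube_boundary_faces)
        fix ie assume "ie \<in> A \<times> {0, 1::nat}"
        then obtain i e where ie: "ie = (i, e)" "i \<in> A" "e \<in> {0, 1}" by blast
        show "closed (case ie of (i, e) \<Rightarrow> grid_cube (q(i := q i + e)) (A - {i}))"
          using ie by (simp add: closed_grid_cube)
        have "card (A - {i}) < k" using True fin ie(2) by (metis card_Diff1_less)
        then have "continuous_map (top_of_set (grid_cube (q(i := q i + e)) (A - {i})))
            (realization (Z (q(i := q i + e)) (A - {i}))) G"
          using True by (intro G) auto
        then show "continuous_map (top_of_set (case ie of (i, e) \<Rightarrow> grid_cube (q(i := q i + e)) (A - {i})))
            (realization (Z q A)) G"
          using continuous_map_realization_mono mono ie True by (metis (no_types, lifting) case_prod_conv)
      qed
      from grid_cube_extension[OF fin pi this] True show ?thesis by blast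
    qed blast
    note ex_g = this
    define g where "g q A = (SOME g. A \<subseteq> {..<n} \<and> card A = k \<longrightarrow>
        continuous_map (top_of_set (grid_cube q A)) (realization (Z q A)) g \<and>
        (\<forall>x\<in>grid_cube_boundary q A. g x = G x))" for q A
    have g: "\<And>q A. A \<subseteq> {..<n} \<Longrightarrow> card A = k \<Longrightarrow>
        continuous_map (top_of_set (grid_cube q A)) (realization (Z q A)) (g q A) \<and>
        (\<forall>x\<in>grid_cube_boundary q A. g q A x = G x)"
      unfolding g_def using someI_ex[OF ex_g] by blast
    \<comment> \<open>Lower skeleta keep their values. A point interior to a cube of dimension
      \<open>k\<close> uses the extension chosen for that cube; values on cubes of higher dimension
      are still arbitrary.\<close>
    define G' where "G' x = (if card {i. x i \<notin> \<int>} < k then G x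
      else g (\<lambda>i. nat \<lfloor>x i\<rfloor>) {i. x i \<notin> \<int>} x)" for x
    have "continuous_map (top_of_set (grid_cube q A)) (realization (Z q A)) G'"
      if A: "A \<subseteq> {..<n}" "card A < Suc k" for q A
    proof (cases "card A = k")
      case True
      have fin: "finite A" using A finite_subset by blast
      have "g q A x = G' x" if x: "x \<in> grid_cube q A" for x
      proof (cases "x \<in> grid_cube_boundary q A")
        case True
        then have "card {i. x i \<notin> \<int>} < k"
          using psubset_card_mono[OF fin grid_cube_boundary_nonint_psubset] \<open>card A = k\<close> by blast
        with True g[OF A(1) \<open>card A = k\<close>] show ?thesis by (simp add: G'_def)
      next
        case False
        then show ?thesis using grid_cube_interior[OF x] \<open>card A = k\<close> by (simp add: G'_def)
      qed
      then show ?thesis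
        by (intro continuous_map_eq[OF conjunct1[OF g[OF A(1) True]]]) simp
    next
      case False
      with A have lt: "card A < k" by simp
      have fin: "finite A" using A finite_subset by blast
      have "G x = G' x" if x: "x \<in> grid_cube q A" for x
        using card_mono[OF fin grid_cube_nonint_subset[OF x]] lt by (simp add: G'_def)
      then show ?thesis
        by (intro continuous_map_eq[OF G[OF A(1) lt]]) simp
    qed
    then show ?case by blast
  qed simp
  then obtain G where G: "\<forall>q A. A \<subseteq> {..<n} \<and> card A < Suc n \<longrightarrow>
      continuous_map (top_of_set (grid_cube q A)) (realization (Z q A)) G" by blast
  have "card A < Suc n" if "A \<subseteq> {..<n}" for A
    using card_mono[OF _ that] by simp
  with G show ?thesis by blast
qed

section \<open>The box as a finite union of grid cubes\<close>

lemma box_real_grid_cubes: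
  assumes "0 < p"
  shows "box_real n (real p) =
    (\<Union>q\<in>{q. \<forall>i. (i \<in> {..<n} \<longrightarrow> q i \<in> {..<p}) \<and> (i \<notin> {..<n} \<longrightarrow> q i = 0)}. grid_cube q {..<n})"
    (is "?B = (\<Union>q\<in>?Q. _ q)")
proof
  show "?B \<subseteq> (\<Union>q\<in>?Q. grid_cube q {..<n})"
  proof
    fix x assume x: "x \<in> ?B"
    \<comment> \<open>The cap \<open>p - 1\<close> assigns points with \<open>x i = p\<close> to the
      last cube, since the cube starting at \<open>p\<close> would leave the box.\<close>
    define q where "q i = (if i < n then min (nat \<lfloor>x i\<rfloor>) (p - 1) else 0)" for i
    have "real (q i) \<le> x i \<and> x i \<le> real (q i) + 1" if "i < n" for i
    proof -
      have xi: "0 \<le> x i" "x i \<le> real p" using x that by (auto simp: box_real_def)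
      show ?thesis
      proof (cases "nat \<lfloor>x i\<rfloor> \<le> p - 1")
        case True
        then show ?thesis using that xi by (simp add: q_def min_def of_nat_nat)
      next
        case False
        then have "q i = p - 1" using that by (simp add: q_def)
        then have "real (q i) = real p - 1" using assms by (simp add: of_nat_diff)
        moreover have "real p \<le> x i" using False xi assms by linarith
        ultimately show ?thesis using xi by simp
      qed
    qed
    then have "x \<in> grid_cube q {..<n}"
      using x by (auto simp: grid_cube_def box_real_def q_def)
    moreover have "q \<in> ?Q" using assms by (auto simp: q_def min_def)
    ultimately show "x \<in> (\<Union>q\<in>?Q. grid_cube q {..<n})" by blast
  qed
  have "x \<in> ?B" if q: "q \<in> ?Q" and x: "x \<in> grid_cube q {..<n}" for q x
  proof -
    have "0 \<le> x i \<and> x i \<le> real p" if "i < n" for i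
    proof -
      have "real (q i) \<le> x i" "x i \<le> real (q i) + 1" using x that by (auto simp: grid_cube_def)
      moreover have "q i < p" using q that by auto
      ultimately show ?thesis by linarith
    qed
    with q x show ?thesis by (auto simp: box_real_def grid_cube_def)
  qed
  then show "(\<Union>q\<in>?Q. grid_cube q {..<n}) \<subseteq> ?B" by blast
qed

lemma continuous_map_box_real:
  assumes "0 < p"
    and "\<And>q. continuous_map (top_of_set (grid_cube q {..<n})) X f"
  shows "continuous_map (top_of_set (box_real n (real p))) X f"
proof (rule continuous_map_finite_closed_cover[OF _ _ box_real_grid_cubes[OF assms(1)]])
  show "finite {q :: nat \<Rightarrow> nat. \<forall>i. (i \<in> {..<n} \<longrightarrow> q i \<in> {..<p}) \<and> (i \<notin> {..<n} \<longrightarrow> q i = 0)}"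
    by (rule finite_set_of_finite_funs) auto
qed (use assms(2) in \<open>auto simp: closed_grid_cube\<close>)

section \<open>A map encoding the missed members of the families\<close>

text \<open>The positive part of the gap between the coordinates on \<open>\<sigma>\<close> and
  those off it. For a point of the polyhedron and a nonempty simplex, multiplying by
  \<open>card \<sigma>\<close> gives the coordinate at the barycentre of \<open>\<sigma>\<close> in
  the barycentric subdivision.\<close>

definition peak :: "'a set \<Rightarrow> ('a \<Rightarrow> real) \<Rightarrow> real" where
  "peak \<sigma> y = max 0 (Min (y ` \<sigma>) - Max (insert 0 (y ` ({v. y v \<noteq> 0} - \<sigma>))))"

text \<open>Replacing the support by \<open>\<tau>\<close> only adds coordinates equal to 0, and 0
  is already in the set. The maximum then runs over a fixed index set, as continuity
  requires.\<close>

lemma peak_on_closed_simplex: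
  assumes "y \<in> closed_simplex \<tau>"
  shows "peak \<sigma> y = max 0 (Min (y ` \<sigma>) - Max (insert 0 (y ` (\<tau> - \<sigma>))))"
proof -
  have "insert 0 (y ` ({v. y v \<noteq> 0} - \<sigma>)) = insert 0 (y ` (\<tau> - \<sigma>))"
    using assms by (auto simp: closed_simplex_def)
  then show ?thesis by (simp add: peak_def)
qed

lemma continuous_on_peak:
  assumes "finite \<tau>" "\<sigma> \<subseteq> \<tau>" "\<sigma> \<noteq> {}"
  shows "continuous_on (closed_simplex \<tau>) (peak \<sigma>)"
proof -
  have fin: "finite \<sigma>" using assms finite_subset by blast
  have "continuous_on S (\<lambda>y. Min (y ` \<sigma>))" for S :: "('a \<Rightarrow> real) set"
    using fin assms(3) by (intro continuous_on_Min_image continuous_on_coord)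
  moreover have "continuous_on S (\<lambda>y. Max (insert 0 (y ` (\<tau> - \<sigma>))))" for S :: "('a \<Rightarrow> real) set"
  proof (cases "\<tau> - \<sigma> = {}")
    case False
    then have "continuous_on S (\<lambda>y. max 0 (Max (y ` (\<tau> - \<sigma>))))"
      using assms(1) continuous_on_Max_image[of "\<tau> - \<sigma>" S "\<lambda>v y. y v"]
      by (intro continuous_on_max continuous_on_const) (auto intro: continuous_on_coord)
    then show ?thesis using False assms(1) by simp
  next
    case True
    show ?thesis unfolding True by simp
  qed
  ultimately have "continuous_on (closed_simplex \<tau>)
      (\<lambda>y. max 0 (Min (y ` \<sigma>) - Max (insert 0 (y ` (\<tau> - \<sigma>)))))"
    by (intro continuous_on_max continuous_on_const continuous_on_diff)
  then show ?thesis
    by (rule continuous_on_eq) (simp add: peak_on_closed_simplex)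
qed

lemma peak_nonneg: "0 \<le> peak \<sigma> y"
  by (simp add: peak_def)

lemma peak_eq_0:
  assumes "finite {v. y v \<noteq> 0}" "finite \<sigma>" "\<not> \<sigma> \<subseteq> {v. y v \<noteq> 0}"
  shows "peak \<sigma> y = 0"
proof -
  obtain v where "v \<in> \<sigma>" "y v = 0" using assms(3) by blast
  then have "Min (y ` \<sigma>) \<le> 0" using assms(2) by (metis Min_le finite_imageI imageI)
  moreover have "0 \<le> Max (insert 0 (y ` ({v. y v \<noteq> 0} - \<sigma>)))" using assms(1) by simp
  ultimately show ?thesis by (simp add: peak_def)
qed

lemma peak_pos_imp_less:
  assumes "finite {v. y v \<noteq> 0}" "finite \<sigma>" "0 < peak \<sigma> y" "u \<in> \<sigma>" "v \<notin> \<sigma>" "y v \<noteq> 0"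
  shows "y v < y u"
proof -
  have "Min (y ` \<sigma>) \<le> y u" using assms by simp
  moreover have "y v \<le> Max (insert 0 (y ` ({v. y v \<noteq> 0} - \<sigma>)))"
    using assms by (intro Max_ge) auto
  ultimately show ?thesis using assms(3) by (simp add: peak_def split: if_splits)
qed

text \<open>A positive peak puts the coordinates on the face strictly above all others. Two such
  faces are therefore nested, and equal cardinality makes them equal.\<close>

lemma peak_pos_unique:
  assumes fin: "finite {v. y v \<noteq> 0}" and sub: "\<sigma> \<subseteq> {v. y v \<noteq> 0}" "\<sigma>' \<subseteq> {v. y v \<noteq> 0}"
    and pos: "0 < peak \<sigma> y" "0 < peak \<sigma>' y" and card: "card \<sigma> = card \<sigma>'"
  shows "\<sigma> = \<sigma>'"
proof -
  have f: "finite \<sigma>" "finite \<sigma>'" using fin sub finite_subset by blast+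
  have "\<sigma> \<subseteq> \<sigma>' \<or> \<sigma>' \<subseteq> \<sigma>"
  proof (rule ccontr)
    assume "\<not> ?thesis"
    then obtain u v where "u \<in> \<sigma>" "u \<notin> \<sigma>'" "v \<in> \<sigma>'" "v \<notin> \<sigma>" by blast
    then have "y v < y u" "y u < y v"
      using peak_pos_imp_less[OF fin f(1) pos(1)] peak_pos_imp_less[OF fin f(2) pos(2)] sub by blast+
    then show False by simp
  qed
  with f card show ?thesis by (metis card_subset_eq)
qed

text \<open>Among the \<open>n\<close> open intervals of equal length between 0 and the largest coordinate, one
  contains no coordinate.\<close>

lemma ex_large_peak:
  assumes fin: "finite {v. y v \<noteq> 0}" and card: "card {v. y v \<noteq> 0} \<le> n"
    and nonneg: "\<And>v. 0 \<le> y v" and sum1: "(\<Sum>v | y v \<noteq> 0. y v) = 1"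
  obtains \<sigma> where "\<sigma> \<subseteq> {v. y v \<noteq> 0}" "\<sigma> \<noteq> {}" "1 \<le> (real n)\<^sup>2 * peak \<sigma> y"
proof -
  let ?\<tau> = "{v. y v \<noteq> 0}"
  define M where "M = Max (y ` ?\<tau>)"
  have ne: "?\<tau> \<noteq> {}" using sum1 by force
  have n: "0 < n" using card ne fin by (metis card_gt_0_iff less_le_trans)
  have "M \<in> y ` ?\<tau>" unfolding M_def using fin ne by (intro Max_in) auto
  then obtain v0 where v0: "v0 \<in> ?\<tau>" "y v0 = M" by auto
  have leM: "y v \<le> M" if "v \<in> ?\<tau>" for v
    unfolding M_def using fin that by (intro Max_ge) auto
  have Mpos: "0 < M" using v0 nonneg[of v0] by auto
  have "1 \<le> real (card ?\<tau>) * M"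
    using sum_bounded_above[of ?\<tau> y M] leM sum1 by simp
  also have "\<dots> \<le> real n * M" using card Mpos by (intro mult_right_mono) auto
  finally have nM: "1 \<le> real n * M" .
  \<comment> \<open>Pigeonhole: the vertex \<open>v0\<close> attains \<open>M\<close> and lies in
    none of the \<open>n\<close> intervals, which leaves at most \<open>n - 1\<close> vertices to
    occupy them.\<close>
  have "\<exists>l<n. \<forall>v\<in>?\<tau>. \<not> (real l * M / real n < y v \<and> y v < real (Suc l) * M / real n)"
  proof (rule ccontr)
    assume "\<not> ?thesis"
    then have "\<forall>l\<in>{..<n}. \<exists>v\<in>?\<tau>. real l * M / real n < y v \<and> y v < real (Suc l) * M / real n"
      by blast
    then obtain u where u: "\<And>l. l < n \<Longrightarrow> u l \<in> ?\<tau>"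
      "\<And>l. l < n \<Longrightarrow> real l * M / real n < y (u l) \<and> y (u l) < real (Suc l) * M / real n"
      by (metis lessThan_iff)
    have le: "l' \<le> l" if "l < n" "l' < n" "u l = u l'" for l l'
    proof -
      have "real l' * M / real n < real (Suc l) * M / real n"
        using u(2)[OF that(1)] u(2)[OF that(2)] that(3) by simp
      then have "real l' < real (Suc l)" using Mpos n by (simp add: divide_less_cancel mult_less_cancel_right)
      then show ?thesis by simp
    qed
    have "inj_on u {..<n}" by (rule inj_onI) (metis le antisym lessThan_iff)
    moreover have "u l \<noteq> v0" if "l < n" for l
    proof -
      have "real (Suc l) * M / real n \<le> real n * M / real n"
        using that Mpos by (intro divide_right_mono mult_right_mono) auto
      then show ?thesis using u(2)[OF that] v0(2) n by auto
    qed
    then have "u ` {..<n} \<subseteq> ?\<tau> - {v0}" using u(1) by auto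
    ultimately have "n \<le> card (?\<tau> - {v0})"
      using card_inj_on_le[of u "{..<n}" "?\<tau> - {v0}"] fin by simp
    moreover have "card (?\<tau> - {v0}) < card ?\<tau>" using fin v0(1) by (rule card_Diff1_less)
    ultimately show False using card by simp
  qed
  then obtain l where l: "l < n"
    "\<And>v. v \<in> ?\<tau> \<Longrightarrow> \<not> (real l * M / real n < y v \<and> y v < real (Suc l) * M / real n)" by blast
  \<comment> \<open>The vertices above the empty interval. Their peak is at least its length
    \<open>M / n\<close>, and \<open>M\<close> is at least \<open>1 / n\<close> because at most
    \<open>n\<close> coordinates sum to 1.\<close>
  define \<sigma> where "\<sigma> = {v \<in> ?\<tau>. real (Suc l) * M / real n \<le> y v}"
  have "real (Suc l) * M / real n \<le> real n * M / real n"
    using l(1) Mpos by (intro divide_right_mono mult_right_mono) auto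
  then have "v0 \<in> \<sigma>" using v0 n by (simp add: \<sigma>_def)
  then have \<sigma>ne: "\<sigma> \<noteq> {}" by blast
  have \<sigma>fin: "finite \<sigma>" using fin by (simp add: \<sigma>_def)
  have "real (Suc l) * M / real n \<le> Min (y ` \<sigma>)"
    using \<sigma>ne \<sigma>fin by (auto simp: \<sigma>_def)
  moreover have "Max (insert 0 (y ` (?\<tau> - \<sigma>))) \<le> real l * M / real n"
    using fin Mpos l(2) by (force simp: \<sigma>_def)
  moreover have "real (Suc l) * M / real n = real l * M / real n + M / real n"
    by (simp only: of_nat_Suc distrib_right add_divide_distrib mult_1 add.commute)
  ultimately have "M / real n \<le> peak \<sigma> y" by (simp add: peak_def)
  then have "(real n)\<^sup>2 * (M / real n) \<le> (real n)\<^sup>2 * peak \<sigma> y"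
    by (intro mult_left_mono) auto
  moreover have "(real n)\<^sup>2 * (M / real n) = real n * M"
    using n by (simp add: power2_eq_square)
  ultimately have "1 \<le> (real n)\<^sup>2 * peak \<sigma> y" using nM by linarith
  with \<sigma>ne show thesis by (intro that[of \<sigma>]) (auto simp: \<sigma>_def)
qed

text \<open>The faces with positive peak at a given point form a chain: the simplex of the barycentric
  subdivision containing that point.\<close>

lemma barycentric_map_exists:
  fixes k :: "nat \<Rightarrow> 'a set \<Rightarrow> nat"
  assumes Y: "abstract_complex Y" and dim: "\<forall>\<sigma>\<in>Y. card \<sigma> \<le> n"
    and k: "\<And>j \<sigma>. k j \<sigma> \<le> p"
  shows "\<exists>Q. continuous_map (realization Y) euclidean Q \<and>
    (\<forall>y\<in>topspace (realization Y). Q y \<in> box_real n (real p) \<and>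
      (\<exists>j<n. \<exists>\<sigma>. \<sigma> \<subseteq> {v. y v \<noteq> 0} \<and> \<sigma> \<noteq> {} \<and> Q y j = real (k j \<sigma>)))"
proof -
  \<comment> \<open>The factor \<open>n\<^sup>2\<close> makes the weight reach 1 at the large peak
    supplied by \<open>ex_large_peak\<close>, so that \<open>Q y j\<close> equals the integer
    \<open>k j \<sigma>\<close> there.\<close>
  define W where "W j y \<sigma> = min 1 ((real n)\<^sup>2 * peak \<sigma> y) * real (k j \<sigma>)" for j y \<sigma>
  define Q where "Q y j = (if j < n then min (real p)
      (\<Sum>\<sigma> | \<sigma> \<subseteq> {v. y v \<noteq> 0} \<and> card \<sigma> = Suc j. W j y \<sigma>) else 0)" for y j
  have W_nonneg: "0 \<le> W j y \<sigma>" for j y \<sigma>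
    by (simp add: W_def peak_nonneg)
  have "continuous_on (closed_simplex \<tau>) Q" if \<tau>: "\<tau> \<in> Y" for \<tau>
  proof (rule continuous_on_coordinatewise_then_product)
    fix j
    have fin: "finite \<tau>" using Y \<tau> by (auto simp: abstract_complex_def)
    \<comment> \<open>The support varies with \<open>y\<close>; summing over the faces of
      \<open>\<tau>\<close> instead gives a fixed finite sum of continuous functions, the extra
      terms being 0.\<close>
    have eq: "(\<Sum>\<sigma> | \<sigma> \<subseteq> \<tau> \<and> card \<sigma> = Suc j. W j y \<sigma>)
        = (\<Sum>\<sigma> | \<sigma> \<subseteq> {v. y v \<noteq> 0} \<and> card \<sigma> = Suc j. W j y \<sigma>)"
      if y: "y \<in> closed_simplex \<tau>" for y
    proof (rule sum.mono_neutral_right)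
      have sub: "{v. y v \<noteq> 0} \<subseteq> \<tau>" using y by (auto simp: closed_simplex_def)
      show "finite {\<sigma>. \<sigma> \<subseteq> \<tau> \<and> card \<sigma> = Suc j}" using fin by simp
      show "{\<sigma>. \<sigma> \<subseteq> {v. y v \<noteq> 0} \<and> card \<sigma> = Suc j} \<subseteq> {\<sigma>. \<sigma> \<subseteq> \<tau> \<and> card \<sigma> = Suc j}"
        using sub by blast
      have "W j y \<sigma> = 0" if "\<sigma> \<subseteq> \<tau>" "\<not> \<sigma> \<subseteq> {v. y v \<noteq> 0}" for \<sigma>
      proof -
        have "peak \<sigma> y = 0"
          using that sub fin by (intro peak_eq_0) (auto intro: finite_subset)
        then show ?thesis by (simp add: W_def)
      qed
      then show "\<forall>\<sigma>\<in>{\<sigma>. \<sigma> \<subseteq> \<tau> \<and> card \<sigma> = Suc j} - {\<sigma>. \<sigma> \<subseteq> {v. y v \<noteq> 0} \<and> card \<sigma> = Suc j}. W j y \<sigma> = 0"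
        by blast
    qed
    have "continuous_on (closed_simplex \<tau>) (\<lambda>y. W j y \<sigma>)" if "\<sigma> \<subseteq> \<tau>" "card \<sigma> = Suc j" for \<sigma>
    proof -
      have "\<sigma> \<noteq> {}" using that(2) by auto
      then show ?thesis
        unfolding W_def by (intro continuous_on_mult continuous_on_min continuous_on_const
            continuous_on_peak[OF fin that(1)])
    qed
    then have "continuous_on (closed_simplex \<tau>)
        (\<lambda>y. min (real p) (\<Sum>\<sigma> | \<sigma> \<subseteq> \<tau> \<and> card \<sigma> = Suc j. W j y \<sigma>))"
      by (intro continuous_on_min continuous_on_const continuous_on_sum) auto
    then have "continuous_on (closed_simplex \<tau>) (\<lambda>y. Q y j)" if "j < n"
      by (rule continuous_on_eq) (simp add: Q_def that eq)
    then show "continuous_on (closed_simplex \<tau>) (\<lambda>y. Q y j)"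
      by (cases "j < n") (auto simp: Q_def)
  qed
  then have "continuous_map (realization Y) euclidean Q"
    by (rule continuous_map_from_realization)
  moreover have "Q y \<in> box_real n (real p)" for y
    by (auto simp: Q_def box_real_def intro!: sum_nonneg W_nonneg)
  moreover have "\<exists>j<n. \<exists>\<sigma>. \<sigma> \<subseteq> {v. y v \<noteq> 0} \<and> \<sigma> \<noteq> {} \<and> Q y j = real (k j \<sigma>)"
    if y: "y \<in> topspace (realization Y)" for y
  proof -
    have supp: "{v. y v \<noteq> 0} \<in> Y" and nonneg: "\<And>v. 0 \<le> y v" and sum1: "(\<Sum>v | y v \<noteq> 0. y v) = 1"
      using y by (simp_all add: mem_realization_iff[OF Y])
    have fin: "finite {v. y v \<noteq> 0}" using Y supp by (auto simp: abstract_complex_def)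
    obtain \<sigma> where \<sigma>: "\<sigma> \<subseteq> {v. y v \<noteq> 0}" "\<sigma> \<noteq> {}" "1 \<le> (real n)\<^sup>2 * peak \<sigma> y"
      by (rule ex_large_peak[OF fin bspec[OF dim supp] nonneg sum1])
    have \<sigma>fin: "finite \<sigma>" using \<sigma>(1) fin finite_subset by blast
    define j where "j = card \<sigma> - 1"
    have cj: "card \<sigma> = Suc j" using \<sigma>(2) \<sigma>fin by (simp add: j_def card_gt_0_iff)
    have "card \<sigma> \<le> n" using card_mono[OF fin \<sigma>(1)] bspec[OF dim supp] by simp
    then have jn: "j < n" using cj by simp
    have pos: "0 < peak \<sigma> y" using \<sigma>(3) peak_nonneg[of \<sigma> y] by (cases "peak \<sigma> y = 0") auto
    have "W j y \<sigma>' = 0" if "\<sigma>' \<subseteq> {v. y v \<noteq> 0}" "card \<sigma>' = Suc j" "\<sigma>' \<noteq> \<sigma>" for \<sigma>'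
    proof -
      have "\<not> 0 < peak \<sigma>' y"
        using peak_pos_unique[OF fin that(1) \<sigma>(1) _ pos] that cj by auto
      then have "peak \<sigma>' y = 0" using peak_nonneg[of \<sigma>' y] by simp
      then show ?thesis by (simp add: W_def)
    qed
    \<comment> \<open>By \<open>peak_pos_unique\<close>, \<open>\<sigma>\<close> is the only face of
      its cardinality that contributes.\<close>
    then have "(\<Sum>\<sigma>' | \<sigma>' \<subseteq> {v. y v \<noteq> 0} \<and> card \<sigma>' = Suc j. W j y \<sigma>') = (\<Sum>\<sigma>'\<in>{\<sigma>}. W j y \<sigma>')"
      using fin \<sigma>(1) cj by (intro sum.mono_neutral_right) auto
    then have "Q y j = real (k j \<sigma>)"
      using jn \<sigma>(3) k[of j \<sigma>] by (simp add: Q_def W_def)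
    with jn \<sigma> show ?thesis by blast
  qed
  ultimately show ?thesis by blast
qed

section \<open>The colourful Helly theorem\<close>

text \<open>The enumeration is total, repeating \<open>h 0\<close> from \<open>card F\<close> on, so
  that every integer hyperplane of the grid has a member attached to it; the bound
  \<open>card F\<close> limits the size of the box.\<close>

lemma nat_enumeration:
  assumes "finite F" "F \<noteq> {}"
  obtains e :: "nat \<Rightarrow> 'b" where "range e = F" "\<And>T. T \<in> F \<Longrightarrow> \<exists>m<card F. e m = T"
proof -
  obtain h where h: "bij_betw h {0..<card F} F"
    using ex_bij_betw_nat_finite[OF assms(1)] by blast
  have pos: "0 < card F" using assms by (simp add: card_gt_0_iff)
  define e where "e m = (if m < card F then h m else h 0)" for m
  have surj: "\<exists>m<card F. e m = T" if "T \<in> F" for T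
  proof -
    have "T \<in> h ` {0..<card F}" using h that by (simp add: bij_betw_def)
    then obtain m where "m < card F" "h m = T" by auto
    then show ?thesis by (intro exI[of _ m]) (simp add: e_def)
  qed
  moreover have "e m \<in> F" for m
    using bij_betwE[OF h] pos by (simp add: e_def)
  ultimately have "range e = F" by blast
  then show thesis using surj by (rule that)
qed

theorem corollary4:
  fixes d :: nat
    and Y :: "'a set set"
    and F :: "nat \<Rightarrow> 'a set set set"
  assumes "d \<ge> 1"
    and "abstract_complex Y"
    and "locally_finite_complex Y"
    and "complex_of_dim d Y"
    and "pi_trivial (int d) (realization Y)"
    and "\<And>i. i \<in> {1..d+1} \<Longrightarrow> finite (F i)"
    and "\<And>i S. i \<in> {1..d+1} \<Longrightarrow> S \<in> F i \<Longrightarrow> subcomplex S Y"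
    and "\<And>I S. I \<subseteq> {1..d+1} \<Longrightarrow> I \<noteq> {} \<Longrightarrow> (\<And>i. i \<in> I \<Longrightarrow> S i \<in> F i) \<Longrightarrow>
           pi_trivial (int d - int (card I)) (realization (\<Inter>i\<in>I. S i))"
  shows "\<exists>y \<in> topspace (realization Y). \<exists>i \<in> {1..d+1}.
           \<forall>S \<in> F i. y \<in> topspace (realization S)"
proof (rule ccontr)
  assume contra: "\<not> ?thesis"
  let ?n = "d + 1"
  have dim: "\<forall>\<sigma>\<in>Y. card \<sigma> \<le> ?n"
    using assms(4) by (simp add: complex_of_dim_def)
  have uniform: "\<exists>y. y \<in> closed_simplex \<sigma>" if "\<sigma> \<in> Y" for \<sigma>
  proof -
    have "finite \<sigma>" "\<sigma> \<noteq> {}" using assms(2) that by (auto simp: abstract_complex_def)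
    then have "(\<lambda>v. if v \<in> \<sigma> then 1 / real (card \<sigma>) else 0) \<in> closed_simplex \<sigma>"
      by (simp add: closed_simplex_def)
    then show ?thesis by blast
  qed
  \<comment> \<open>A simplex lying in every member of a family would make its barycentre a common
    point. Axes are numbered from 0 and families from 1, hence \<open>Suc j\<close>.\<close>
  have missed: "\<exists>T\<in>F (Suc j). \<sigma> \<notin> T" if j: "j < ?n" and \<sigma>: "\<sigma> \<in> Y" for j \<sigma>
  proof (rule ccontr)
    assume "\<not> ?thesis"
    then have "\<forall>T\<in>F (Suc j). \<sigma> \<in> T" by blast
    moreover obtain y where "y \<in> closed_simplex \<sigma>" using uniform[OF \<sigma>] by blast
    ultimately have "\<forall>T\<in>F (Suc j). y \<in> topspace (realization T)" "y \<in> topspace (realization Y)"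
      using \<sigma> by (auto simp: topspace_realization)
    moreover have "Suc j \<in> {1..d+1}" using j by auto
    ultimately show False using contra by blast
  qed
  obtain \<sigma>0 where "\<sigma>0 \<in> Y" using assms(4) by (auto simp: complex_of_dim_def)
  then have F: "finite (F (Suc j))" "F (Suc j) \<noteq> {}" if "j < ?n" for j
    using missed[OF that] assms(6) that by auto
  have "\<exists>e. range e = F (Suc j) \<and> (\<forall>T\<in>F (Suc j). \<exists>m<card (F (Suc j)). e m = T)" if "j < ?n" for j
    using nat_enumeration[OF F[OF that]] by metis
  then have "\<forall>j\<in>{..<?n}. \<exists>e. range e = F (Suc j) \<and> (\<forall>T\<in>F (Suc j). \<exists>m<card (F (Suc j)). e m = T)"
    by blast
  from bchoice[OF this] obtain S :: "nat \<Rightarrow> nat \<Rightarrow> 'a set set" where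
    S: "\<forall>j\<in>{..<?n}. range (S j) = F (Suc j) \<and> (\<forall>T\<in>F (Suc j). \<exists>m<card (F (Suc j)). S j m = T)"
    by blast
  have S_in: "S j m \<in> F (Suc j)" if "j < ?n" for j m
    using S that by blast
  have S_sub: "abstract_complex (S j m)" "S j m \<subseteq> Y" if "j < ?n" for j m
    using assms(7)[OF _ S_in[OF that, of m]] that by (auto simp: subcomplex_def)
  \<comment> \<open>One side length for all axes, beyond every enumeration index in use;
    \<open>Suc\<close> makes it positive.\<close>
  define p where "p = Suc (\<Sum>j<?n. card (F (Suc j)))"
  have "\<exists>m\<le>p. j < ?n \<and> \<sigma> \<in> Y \<longrightarrow> \<sigma> \<notin> S j m" for j \<sigma>
  proof (cases "j < ?n \<and> \<sigma> \<in> Y")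
    case True
    then obtain T where T: "T \<in> F (Suc j)" "\<sigma> \<notin> T" using missed by blast
    then obtain m where m: "m < card (F (Suc j))" "S j m = T" using S True by blast
    have "card (F (Suc j)) \<le> (\<Sum>j<?n. card (F (Suc j)))"
      using True by (intro member_le_sum) auto
    with m(1) have "m \<le> p" by (simp add: p_def)
    with T m show ?thesis by blast
  qed blast
  then obtain k where k: "\<And>j \<sigma>. k j \<sigma> \<le> p"
    "\<And>j \<sigma>. j < ?n \<Longrightarrow> \<sigma> \<in> Y \<Longrightarrow> \<sigma> \<notin> S j (k j \<sigma>)"
    by metis
  obtain Q where Q: "continuous_map (realization Y) euclidean Q"
    "\<forall>y\<in>topspace (realization Y). Q y \<in> box_real ?n (real p) \<and>
      (\<exists>j<?n. \<exists>\<sigma>. \<sigma> \<subseteq> {v. y v \<noteq> 0} \<and> \<sigma> \<noteq> {} \<and> Q y j = real (k j \<sigma>))"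
    using barycentric_map_exists[where k = k, OF assms(2) dim k(1)] by (elim exE conjE)
  \<comment> \<open>Each frozen coordinate \<open>i\<close> with value \<open>q i\<close> prescribes
    the member \<open>S i (q i)\<close>. Intersecting with \<open>Y\<close> gives the right target
    when no coordinate is frozen.\<close>
  define Z where "Z q A = Y \<inter> (\<Inter>i\<in>{..<?n} - A. S i (q i))" for q A
  have "\<exists>G. \<forall>q A. A \<subseteq> {..<?n} \<longrightarrow>
      continuous_map (top_of_set (grid_cube q A)) (realization (Z q A)) G"
  proof (rule grid_map_exists)
    show "Z (q(i := q i + e)) (A - {i}) \<subseteq> Z q A" if "i \<in> A" for q A i e
    proof
      fix \<sigma> assume \<sigma>: "\<sigma> \<in> Z (q(i := q i + e)) (A - {i})"
      have "\<sigma> \<in> S l (q l)" if "l \<in> {..<?n} - A" for l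
      proof -
        have "l \<noteq> i" "l \<in> {..<?n} - (A - {i})" using that \<open>i \<in> A\<close> by auto
        with \<sigma> show ?thesis by (force simp: Z_def)
      qed
      with \<sigma> show "\<sigma> \<in> Z q A" by (simp add: Z_def)
    qed
    show "pi_trivial (int (card A) - 1) (realization (Z q A))" if A: "A \<subseteq> {..<?n}" for q A
    proof (cases "A = {..<?n}")
      case True
      then show ?thesis using assms(5) by (simp add: Z_def)
    next
      case False
      with A have ne: "{..<?n} - A \<noteq> {}" by blast
      let ?I = "Suc ` ({..<?n} - A)"
      have "card ?I = ?n - card A"
        using A by (simp add: card_image card_Diff_subset finite_subset[OF A])
      moreover have "card A \<le> ?n" using card_mono[OF _ A] by simp
      ultimately have "int d - int (card ?I) = int (card A) - 1" by simp
      moreover have "(\<Inter>i\<in>?I. S (i - 1) (q (i - 1))) = Z q A"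
        using ne S_sub(2) by (fastforce simp: Z_def)
      moreover have "pi_trivial (int d - int (card ?I)) (realization (\<Inter>i\<in>?I. S (i - 1) (q (i - 1))))"
        using ne S_in by (intro assms(8)) auto
      ultimately show ?thesis by simp
    qed
  qed
  then obtain G where G: "\<And>q A. A \<subseteq> {..<?n} \<Longrightarrow>
      continuous_map (top_of_set (grid_cube q A)) (realization (Z q A)) G"
    by blast
  have p: "0 < p" by (simp add: p_def)
  have GY: "continuous_map (top_of_set (box_real ?n (real p))) (realization Y) G"
    using G[of "{..<?n}"] by (intro continuous_map_box_real[OF p]) (simp add: Z_def)
  have "continuous_on (box_real ?n (real p)) (Q \<circ> G)"
    using continuous_map_compose[OF GY Q(1)] by simp
  moreover have G_in: "G x \<in> topspace (realization Y)" if "x \<in> box_real ?n (real p)" for x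
    using continuous_map_image_subset_topspace[OF GY] that by auto
  ultimately obtain x where x: "x \<in> box_real ?n (real p)" "(Q \<circ> G) x = x"
    using brouwer_box_real[of "real p" ?n "Q \<circ> G"] p bspec[OF Q(2)]
    by (metis comp_apply of_nat_0_less_iff)
  obtain j \<sigma> where j: "j < ?n" "\<sigma> \<subseteq> {v. G x v \<noteq> 0}" "\<sigma> \<noteq> {}" "x j = real (k j \<sigma>)"
    using bspec[OF Q(2) G_in[OF x(1)]] x(2) by auto
  have supp: "{v. G x v \<noteq> 0} \<in> Y"
    using G_in[OF x(1)] by (simp add: mem_realization_iff[OF assms(2)])
  have "x \<in> (\<Union>q\<in>{q. \<forall>i. (i \<in> {..<?n} \<longrightarrow> q i \<in> {..<p}) \<and> (i \<notin> {..<?n} \<longrightarrow> q i = 0)}. grid_cube q {..<?n})"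
    using x(1) unfolding box_real_grid_cubes[OF p] .
  then obtain q where q: "x \<in> grid_cube q {..<?n}" by blast
  \<comment> \<open>Since \<open>x j\<close> is the integer \<open>k j \<sigma>\<close>, the point
    also lies in a cube with direction \<open>j\<close> frozen there, whose image lies in
    \<open>S j (k j \<sigma>)\<close>.\<close>
  have "x \<in> grid_cube (q(j := k j \<sigma>)) ({..<?n} - {j})"
    using q j by (auto simp: grid_cube_def)
  then have "G x \<in> topspace (realization (Z (q(j := k j \<sigma>)) ({..<?n} - {j})))"
    using continuous_map_image_subset_topspace[OF G, of "{..<?n} - {j}" "q(j := k j \<sigma>)"] by auto
  moreover have "Z (q(j := k j \<sigma>)) ({..<?n} - {j}) \<subseteq> S j (k j \<sigma>)"
    using j(1) by (auto simp: Z_def)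
  ultimately have "G x \<in> topspace (realization (S j (k j \<sigma>)))"
    by (auto simp: topspace_realization)
  then have "{v. G x v \<noteq> 0} \<in> S j (k j \<sigma>)"
    by (simp add: mem_realization_iff[OF S_sub(1)[OF j(1)]])
  \<comment> \<open>The subcomplex contains the support of \<open>G x\<close>, hence its face
    \<open>\<sigma>\<close>, against the choice of \<open>k\<close>.\<close>
  then have "\<sigma> \<in> S j (k j \<sigma>)"
    using S_sub(1)[OF j(1)] j(2,3) unfolding abstract_complex_def by blast
  moreover have "\<sigma> \<in> Y"
    using assms(2) supp j(2,3) unfolding abstract_complex_def by blast
  ultimately show False using k(2)[OF j(1)] by blast
qed

end
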